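(* Let $N=2^{\mathsf n}>4$ and $t\ge1$ an integer. Let $\mathbf Y_{\mathsf n}$ be the set of $\mathsf n$-qubit Pauli operators (tensor products of $\mathbf 1_2,\sigma^x,\sigma^y,\sigma^z$) containing an odd number of tensor factors equal to $\sigma^y$. Then \[ \Big\|\mathbb E_{\theta\sim(-2\pi,2\pi),\,P\in\mathbf Y_{\mathsf n}}\big(e^{\mathrm i\theta P/2}\big)^{\otimes t}-\mathbb E_{O\sim\mathrm{SO}(N)}O^{\otimes t}\Big\|\le1-\frac1{2t}\frac{N-2}{N-1}-\frac2{N(N-1)}, \] where $\theta$ and $P$ are independent and uniform and $O$ is Haar-distributed on $\mathrm{SO}(N)$.
   Context: For $P\in\mathbf Y_{\mathsf n}$, $\mathrm iP$ is a real antisymmetric matrix, so $e^{\mathrm i\theta P/2}\in\mathrm{SO}(N)$. $\|\cdot\|$ is the operator norm. *)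

theory Defs
  imports "HOL-Probability.Probability"
begin

text \<open>Qubits are indexed by a finite type 'q (n = CARD('q)); computational basis states are
  bit strings 'q \<Rightarrow> bool, so N = 2^CARD('q). Matrices are complex^('q\<Rightarrow>bool)^('q\<Rightarrow>bool).\<close>

datatype pauli_letter = PI | PX | PY | PZ

text \<open>Single-qubit Pauli matrices, basis index False = |0>, True = |1>.\<close>
fun pauli1 :: "pauli_letter \<Rightarrow> bool \<Rightarrow> bool \<Rightarrow> complex" where
  "pauli1 PI b c = (if b = c then 1 else 0)"
| "pauli1 PX b c = (if b = c then 0 else 1)"
| "pauli1 PY b c = (if b = c then 0 else if c then - \<i> else \<i>)"
| "pauli1 PZ b c = (if b = c then (if b then -1 else 1) else 0)"

text \<open>n-qubit Pauli operator (tensor product of the letters).\<close>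
definition pauli :: "('q::finite \<Rightarrow> pauli_letter) \<Rightarrow> complex^('q \<Rightarrow> bool)^('q \<Rightarrow> bool)" where
  "pauli a = (\<chi> x y. \<Prod>q\<in>UNIV. pauli1 (a q) (x q) (y q))"

text \<open>Y_n: Pauli operators with an odd number of tensor factors equal to sigma^y.\<close>
definition Ypaulis :: "(complex^('q::finite \<Rightarrow> bool)^('q \<Rightarrow> bool)) set" where
  "Ypaulis = {pauli a | a. odd (card {q. a q = PY})}"

definition mat_pow :: "'a::comm_ring_1^'n::finite^'n \<Rightarrow> nat \<Rightarrow> 'a^'n^'n" where
  "mat_pow A k = (((**) A) ^^ k) (mat 1)"

text \<open>Matrix exponential, entrywise power series.\<close>
definition mat_exp :: "complex^'n::finite^'n \<Rightarrow> complex^'n^'n" where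
  "mat_exp A = (\<chi> i j. (\<Sum>k. (mat_pow A k) $ i $ j / of_nat (fact k)))"

definition cmat_scale :: "complex \<Rightarrow> complex^'n::finite^'m::finite \<Rightarrow> complex^'n^'m" where
  "cmat_scale c A = (\<chi> i j. c * A $ i $ j)"

text \<open>t-fold tensor power; t = CARD('t), the tensor-power index set is 'i^'t.\<close>
definition tensor_pow :: "'a::comm_ring_1^'i::finite^'i \<Rightarrow> 'a^('i^'t::finite)^('i^'t)" where
  "tensor_pow U = (\<chi> x y. \<Prod>k\<in>UNIV. U $ (x $ k) $ (y $ k))"

text \<open>Operator norm (w.r.t. the Euclidean norm) of a square complex matrix.\<close>
definition op_norm :: "complex^'n::finite^'n \<Rightarrow> real" where
  "op_norm M = onorm (\<lambda>v. M *v v)"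

definition SO :: "(real^'n::finite^'n) set" where
  "SO = {R. orthogonal_matrix R \<and> det R = 1}"

text \<open>Haar (probability) measure on SO(N): a Borel probability measure on N x N real matrices,
  concentrated on SO(N) and invariant under left multiplication by SO(N).\<close>
definition is_haar_SO :: "(real^'n::finite^'n) measure \<Rightarrow> bool" where
  "is_haar_SO \<mu> \<longleftrightarrow> prob_space \<mu> \<and> sets \<mu> = sets borel \<and> emeasure \<mu> SO = 1
     \<and> (\<forall>U\<in>SO. distr \<mu> \<mu> (\<lambda>R. U ** R) = \<mu>)"

text \<open>E_{theta ~ U(-2pi,2pi), P ~ U(Y_n)} (exp(i theta P/2))^{\<otimes> t}.\<close>
definition pauli_avg :: "complex^(('q::finite \<Rightarrow> bool)^'t::finite)^(('q \<Rightarrow> bool)^'t)" where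
  "pauli_avg = (\<chi> x y. (1 / of_nat (card (Ypaulis :: (complex^('q \<Rightarrow> bool)^('q \<Rightarrow> bool)) set))) *
      (\<Sum>P\<in>Ypaulis. integral {-2*pi..2*pi}
          (\<lambda>\<theta>. tensor_pow (mat_exp (cmat_scale (\<i> * of_real (\<theta>/2)) P)) $ x $ y) / of_real (4*pi)))"

text \<open>E_{O ~ Haar(SO(N))} O^{\<otimes> t}, as a complex matrix.\<close>
definition haar_avg :: "(real^'i::finite^'i) measure \<Rightarrow> complex^('i^'t::finite)^('i^'t)" where
  "haar_avg \<mu> = (\<chi> x y. complex_of_real (\<integral>R. (tensor_pow R :: real^('i^'t)^('i^'t)) $ x $ y \<partial>\<mu>))"

end

theory Submission
  imports Defs
begin

text \<open>For \<open>P\<close> in \<open>Y\<close> let \<open>H P\<close> be the sum over the tensor factors of \<open>P\<close> acting on that factor.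
  The average over \<open>\<theta>\<close> of the \<open>t\<close>-th tensor power of \<open>exp (i \<theta> P / 2)\<close> is the projection
  onto the kernel of \<open>H P\<close>. The Casimir operator \<open>C\<close>, the sum of all \<open>(H P)\<^sup>2\<close>, commutes with these
  projections and with every \<open>H P\<close>, so it suffices to look at one eigenspace of \<open>C\<close>, with
  eigenvalue \<open>c\<close>, without nonzero \<open>SO(N)\<close>-invariant vectors. If \<open>m\<close> is the largest eigenvalue of any \<open>H P\<close> there, then
  \<open>1\<close> minus the projection is at least \<open>(H P)\<^sup>2 / m\<^sup>2\<close>, so the gap is at least \<open>c / (m\<^sup>2 |Y|)\<close>.
  On an eigenvector of \<open>H J\<close> for \<open>m\<close>, each pair \<open>P\<close>, \<open>iJP\<close> anticommuting with
  \<open>J\<close> contributes exactly \<open>2 m\<close> to \<open>C\<close> by the usual \<open>su(2)\<close> ladder argument, and \<open>J\<close> itself contributes \<open>m\<^sup>2\<close>;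
  counting the \<open>N (N - 2) / 4\<close> anticommuting \<open>P\<close> gives \<open>c \<ge> m\<^sup>2 + m N (N - 2) / 4\<close>,
  which with \<open>m \<le> t\<close> is the claimed bound. If \<open>m = 0\<close>, the eigenvectors are killed by the whole Lie algebra
  and hence \<open>SO(N)\<close>-invariant.\<close>

section \<open>Matrices and tensor powers\<close>

text \<open>Operators are summed over both signs here, so several constants are twice those of the
  overview. Closure under i J P holds for the odd Pauli strings only up to sign; the frame
  \<open>Z\<close> therefore contains \<open>- P\<close> with \<open>P\<close>, has N (N - 1)
  elements, and its \<open>casimir\<close> is bounded below by 2 m^2 + m N (N - 2) / 2. The average
  itself does not change, as \<open>P\<close> and \<open>- P\<close> have the same kernel
  projection.

  Divided by m^2 N (N - 1), the first summand is the term 2 / (N (N - 1)) of the theorem, the share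
  of \<open>J\<close> and \<open>- J\<close>; the second, with m at most t, is the term with 1 / (2
  t).

  The estimate is carried out for abstract frames. Their completeness relation replaces all Pauli
  combinatorics: it yields the size of the frame, the number of elements anticommuting with a given
  one, and the spanning of all antisymmetric matrices.

  Passing from the Lie algebra to the group would usually rest on connectedness of SO(N) or on
  surjectivity of its exponential map. Here unit vectors are moved along circles, which shows that
  all reflections act alike on a vector killed by the Lie algebra, and rotations are factored into
  reflections.\<close>

lemma prod_sum_vec:
  fixes f :: "'t::finite \<Rightarrow> 'i::finite \<Rightarrow> 'a::comm_ring_1"
  shows "(\<Prod>k\<in>UNIV. \<Sum>i\<in>UNIV. f k i) = (\<Sum>y\<in>(UNIV :: ('i^'t) set). \<Prod>k\<in>UNIV. f k (y $ k))"
proof -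
  have "(\<Prod>k\<in>UNIV. \<Sum>i\<in>UNIV. f k i) = (\<Sum>g\<in>UNIV. \<Prod>k\<in>UNIV. f k (g k))"
    by (subst prod_sum_PiE) auto
  also have "\<dots> = (\<Sum>y\<in>(UNIV :: ('i^'t) set). \<Prod>k\<in>UNIV. f k (y $ k))"
    by (rule sum.reindex_bij_witness[where i = vec_nth and j = vec_lambda]) auto
  finally show ?thesis .
qed

lemma matrix_mult_nth: "(A ** B) $ i $ j = (\<Sum>k\<in>UNIV. A $ i $ k * B $ k $ j)"
  by (simp add: matrix_matrix_mult_def)

lemma matrix_vector_mult_nth: "(A *v x) $ i = (\<Sum>k\<in>UNIV. A $ i $ k * x $ k)"
  by (simp add: matrix_vector_mult_def)

lemma mat_nth: "mat c $ i $ j = (if i = j then c else 0)"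
  by (simp add: mat_def)

lemma cmat_scale_nth [simp]: "cmat_scale c A $ i $ j = c * A $ i $ j"
  by (simp add: cmat_scale_def)

lemma matrix_mult_sum_left: "(\<Sum>i\<in>S. A i) ** B = (\<Sum>i\<in>S. A i ** B)"
  by (simp add: vec_eq_iff matrix_mult_nth sum_component sum_distrib_right sum.swap[of _ S])

lemma matrix_mult_sum_right: "B ** (\<Sum>i\<in>S. A i) = (\<Sum>i\<in>S. B ** A i)"
  by (simp add: vec_eq_iff matrix_mult_nth sum_component sum_distrib_left sum.swap[of _ S])

lemma matrix_vector_mult_sum_left: "(\<Sum>i\<in>S. A i) *v x = (\<Sum>i\<in>S. A i *v x)"
  by (simp add: vec_eq_iff matrix_vector_mult_nth sum_component sum_distrib_right sum.swap[of _ S])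

lemma matrix_diff_ldistrib:
  fixes A :: "'a::comm_ring_1^'n^'m"
  shows "A ** (B - C) = A ** B - A ** C"
  by (simp add: vec_eq_iff matrix_mult_nth right_diff_distrib sum_subtractf)

lemma matrix_diff_rdistrib:
  fixes A :: "'a::comm_ring_1^'n^'m"
  shows "(A - B) ** C = A ** C - B ** C"
  by (simp add: vec_eq_iff matrix_mult_nth left_diff_distrib sum_subtractf)

lemma matrix_mult_uminus_left:
  fixes A :: "'a::comm_ring_1^'n^'m"
  shows "(- A) ** B = - (A ** B)"
  by (simp add: vec_eq_iff matrix_mult_nth sum_negf)

lemma matrix_mult_uminus_right:
  fixes A :: "'a::comm_ring_1^'n^'m"
  shows "A ** (- B) = - (A ** B)"
  by (simp add: vec_eq_iff matrix_mult_nth sum_negf)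

lemma cmat_scale_mult_left: "cmat_scale c A ** B = cmat_scale c (A ** B)"
  by (simp add: vec_eq_iff matrix_mult_nth sum_distrib_left mult.assoc)

lemma cmat_scale_mult_right: "A ** cmat_scale c B = cmat_scale c (A ** B)"
  by (simp add: vec_eq_iff matrix_mult_nth sum_distrib_left mult_ac)

lemma cmat_scale_vector: "cmat_scale c A *v x = c *s (A *v x)"
  by (simp add: vec_eq_iff matrix_vector_mult_nth sum_distrib_left mult.assoc)

lemma cmat_scale_scale [simp]: "cmat_scale c (cmat_scale d A) = cmat_scale (c * d) A"
  by (simp add: vec_eq_iff mult.assoc)

lemma cmat_scale_simps [simp]: "cmat_scale 1 A = A" "cmat_scale (-1) A = - A" "cmat_scale 0 A = 0"
  by (simp_all add: vec_eq_iff)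

lemma scaleR_eq_vector_smult: "r *\<^sub>R (x :: complex^'n) = of_real r *s x"
  by (simp add: vec_eq_iff scaleR_conv_of_real[where 'a=complex])

lemma cmat_scale_of_real: "cmat_scale (of_real r) A = r *\<^sub>R A"
  by (simp add: vec_eq_iff scaleR_conv_of_real[where 'a=complex])

lemma matrix_add_rdistrib: "(A + B) ** C = A ** C + B ** C"
  for A :: "'a::comm_ring_1^'n^'m"
  by (simp add: vec_eq_iff matrix_mult_nth distrib_right sum.distrib)

lemma cmat_scale_add: "cmat_scale c (A + B) = cmat_scale c A + cmat_scale c B"
  by (simp add: vec_eq_iff algebra_simps)

lemma cmat_scale_uminus: "cmat_scale c (- A) = cmat_scale (- c) A"
  by (simp add: vec_eq_iff)

lemma cmat_scale_zero_right [simp]: "cmat_scale c 0 = 0"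
  by (simp add: vec_eq_iff)

lemma matrix_mult_zero [simp]: "A ** 0 = 0" "0 ** A = 0"
  for A :: "'a::comm_ring_1^'n^'m"
  by (simp_all add: vec_eq_iff matrix_mult_nth)

lemma cmat_scale_sum: "cmat_scale c (\<Sum>i\<in>S. A i) = (\<Sum>i\<in>S. cmat_scale c (A i))"
  by (simp add: vec_eq_iff sum_component sum_distrib_left)

lemma matrix_vector_uminus: "(- A) *v x = - (A *v x)"
  for A :: "'a::comm_ring_1^'n^'m"
  by (simp add: vec_eq_iff matrix_vector_mult_nth sum_negf)

lemma matrix_vector_smult: "A *v (c *s x) = c *s (A *v x)"
  for A :: "complex^'n^'m"
  by (simp add: vec_eq_iff matrix_vector_mult_nth sum_distrib_left mult_ac)

lemma complex_matrix_vector_scaleR: "A *v (r *\<^sub>R x) = r *\<^sub>R (A *v x)"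
  for A :: "complex^'n^'m"
  by (simp add: scaleR_eq_vector_smult matrix_vector_smult)

lemma commuting_eigenspace:
  fixes A B :: "complex^'n^'n"
  assumes "B ** A = A ** B" "A *v w = c *\<^sub>R w"
  shows "A *v (B *v w) = c *\<^sub>R (B *v w)"
proof -
  have "A *v (B *v w) = B *v (A *v w)"
    by (simp add: matrix_vector_mul_assoc assms(1))
  then show ?thesis by (simp add: assms(2) complex_matrix_vector_scaleR)
qed

lemma smult_ii: "\<i> *s (\<i> *s x) = - (x :: complex^'n)"
  by (simp add: vec_eq_iff)

lemma vector_smult_diff: "c *s (x - y) = c *s x - c *s (y :: complex^'n)"
  by (simp add: vec_eq_iff algebra_simps)

section \<open>Adjoints\<close>

definition mat_adj :: "complex^'n::finite^'m::finite \<Rightarrow> complex^'m^'n" where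
  "mat_adj A = (\<chi> i j. cnj (A $ j $ i))"

lemma mat_adj_nth [simp]: "mat_adj A $ i $ j = cnj (A $ j $ i)"
  by (simp add: mat_adj_def)

lemma mat_adj_mult: "mat_adj (A ** B) = mat_adj B ** mat_adj A"
  by (simp add: vec_eq_iff matrix_mult_nth mult.commute)

lemma mat_adj_one [simp]: "mat_adj (mat 1) = mat 1"
  by (simp add: vec_eq_iff mat_nth)

lemma mat_adj_uminus: "mat_adj (- P) = - mat_adj P"
  by (simp add: vec_eq_iff)

lemma mat_adj_sum: "mat_adj (\<Sum>i\<in>S. A i) = (\<Sum>i\<in>S. mat_adj (A i))"
  by (simp add: vec_eq_iff sum_component)

text \<open>\<open>inner\<close> on complex vectors is the real part of the Hermitian product, with
  the same norm. Complex matrices are thus handled as real-linear maps, and facts on symmetric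
  operators of Euclidean spaces apply.\<close>

lemma inner_mat_adj:
  fixes A :: "complex^'n::finite^'m::finite"
  shows "inner (A *v x) y = inner x (mat_adj A *v y)"
proof -
  have re: "inner u v = Re (cnj u * v)" for u v :: complex
    by (simp add: inner_complex_def)
  have "inner (A *v x) y = Re (\<Sum>i\<in>UNIV. \<Sum>k\<in>UNIV. cnj (A $ i $ k * x $ k) * y $ i)"
    by (simp only: inner_vec_def matrix_vector_mult_nth re cnj_sum sum_distrib_right Re_sum)
  also have "\<dots> = Re (\<Sum>k\<in>UNIV. \<Sum>i\<in>UNIV. cnj (x $ k) * (cnj (A $ i $ k) * y $ i))"
    by (subst sum.swap) (simp add: mult_ac)
  also have "\<dots> = inner x (mat_adj A *v y)"
    by (simp only: inner_vec_def matrix_vector_mult_nth re sum_distrib_left Re_sum mat_adj_nth)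
  finally show ?thesis .
qed

lemma inner_hermitian:
  assumes "mat_adj A = A"
  shows "inner (A *v x) y = inner x (A *v y)"
  by (metis assms inner_mat_adj)

text \<open>Each site gets its own matrix: expanding the tensor power of a sum, or acting on a
  single site, leaves the set of tensor powers.\<close>

definition tensor_family :: "('t::finite \<Rightarrow> 'a::comm_ring_1^'i::finite^'i) \<Rightarrow> 'a^('i^'t)^('i^'t)" where
  "tensor_family F = (\<chi> x y. \<Prod>k\<in>UNIV. F k $ (x $ k) $ (y $ k))"

lemma tensor_family_nth: "tensor_family F $ x $ y = (\<Prod>k\<in>UNIV. F k $ (x $ k) $ (y $ k))"
  by (simp add: tensor_family_def)

lemma tensor_pow_conv_family: "tensor_pow U = tensor_family (\<lambda>_. U)"
  by (simp add: tensor_pow_def tensor_family_def)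

lemma tensor_family_mult:
  fixes F G :: "'t::finite \<Rightarrow> 'a::comm_ring_1^'i::finite^'i"
  shows "tensor_family F ** tensor_family G = tensor_family (\<lambda>k. F k ** G k)"
  by (simp add: vec_eq_iff matrix_mult_nth tensor_family_nth prod_sum_vec prod.distrib)

lemma tensor_family_one:
  "tensor_family (\<lambda>_. mat 1 :: 'a::comm_ring_1^'i::finite^'i) = (mat 1 :: 'a^('i^'t::finite)^('i^'t))"
proof -
  have "(\<Prod>k\<in>UNIV. if x $ k = y $ k then 1 else 0) = (if x = y then 1 else (0::'a))"
    for x y :: "'i^'t"
  proof (cases "x = y")
    case False
    then obtain k where "x $ k \<noteq> y $ k" by (auto simp: vec_eq_iff)
    then have "(\<Prod>k\<in>UNIV. if x $ k = y $ k then 1 else (0::'a)) = 0"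
      by (intro prod_zero) auto
    with False show ?thesis by simp
  qed simp
  then show ?thesis by (simp add: vec_eq_iff tensor_family_nth mat_nth)
qed

lemma tensor_family_zero: "F k = 0 \<Longrightarrow> tensor_family F = 0"
  by (auto simp: vec_eq_iff tensor_family_nth intro!: prod_zero bexI[of _ k])

lemma tensor_family_scale:
  "tensor_family (\<lambda>k. cmat_scale (c k) (F k)) = cmat_scale (\<Prod>k\<in>UNIV. c k) (tensor_family F)"
  by (simp add: vec_eq_iff tensor_family_nth prod.distrib)

lemma tensor_family_add:
  fixes F G :: "'t::finite \<Rightarrow> 'a::comm_ring_1^'i::finite^'i"
  shows "tensor_family (\<lambda>k. F k + G k) = (\<Sum>K\<in>UNIV. tensor_family (\<lambda>k. if k \<in> K then F k else G k))"
proof -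
  have "(\<Prod>k\<in>UNIV. F k $ (x $ k) $ (y $ k) + G k $ (x $ k) $ (y $ k)) =
      (\<Sum>K\<in>UNIV. \<Prod>k\<in>UNIV. (if k \<in> K then F k else G k) $ (x $ k) $ (y $ k))" for x y
  proof -
    have "(\<Prod>k\<in>UNIV. F k $ (x $ k) $ (y $ k) + G k $ (x $ k) $ (y $ k)) =
        (\<Sum>K\<in>UNIV. (\<Prod>k\<in>K. F k $ (x $ k) $ (y $ k)) * (\<Prod>k\<in>UNIV - K. G k $ (x $ k) $ (y $ k)))"
      by (subst prod_add) auto
    also have "\<dots> = (\<Sum>K\<in>UNIV. \<Prod>k\<in>UNIV. (if k \<in> K then F k else G k) $ (x $ k) $ (y $ k))"
    proof (rule sum.cong[OF refl])
      fix K :: "'t set"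
      have "(\<Prod>k\<in>UNIV. (if k \<in> K then F k else G k) $ (x $ k) $ (y $ k)) =
        (\<Prod>k\<in>K. (if k \<in> K then F k else G k) $ (x $ k) $ (y $ k)) *
        (\<Prod>k\<in>UNIV - K. (if k \<in> K then F k else G k) $ (x $ k) $ (y $ k))"
        by (subst prod.subset_diff[of K]) (auto simp: mult.commute)
      also have "\<dots> = (\<Prod>k\<in>K. F k $ (x $ k) $ (y $ k)) * (\<Prod>k\<in>UNIV - K. G k $ (x $ k) $ (y $ k))"
        by (intro arg_cong2[where f="(*)"] prod.cong) auto
      finally show "(\<Prod>k\<in>K. F k $ (x $ k) $ (y $ k)) * (\<Prod>k\<in>UNIV - K. G k $ (x $ k) $ (y $ k)) =
        (\<Prod>k\<in>UNIV. (if k \<in> K then F k else G k) $ (x $ k) $ (y $ k))" by simp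
    qed
    finally show ?thesis .
  qed
  then show ?thesis by (simp add: vec_eq_iff tensor_family_nth sum_component)
qed

lemma tensor_family_upd_nth:
  "tensor_family (F(k := X)) $ x $ y =
    X $ (x $ k) $ (y $ k) * (\<Prod>l\<in>UNIV - {k}. F l $ (x $ l) $ (y $ l))"
  by (subst tensor_family_nth, subst prod.remove[of _ k]) auto

lemma mat_adj_tensor_family: "mat_adj (tensor_family F) = tensor_family (\<lambda>k. mat_adj (F k))"
  by (simp add: vec_eq_iff tensor_family_nth)

section \<open>The derived action on the tensor power\<close>

definition site_op :: "'t::finite \<Rightarrow> 'a::comm_ring_1^'i::finite^'i \<Rightarrow> 'a^('i^'t)^('i^'t)" where
  "site_op k X = tensor_family ((\<lambda>_. mat 1)(k := X))"

text \<open>This is the \<open>H\<close> of the overview: the derivative of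
  \<open>tensor_pow\<close> at the identity, a representation of the matrix Lie algebra.\<close>

definition sum_op :: "'a::comm_ring_1^'i::finite^'i \<Rightarrow> 'a^('i^'t::finite)^('i^'t)" where
  "sum_op X = (\<Sum>k\<in>UNIV. site_op k X)"

lemma site_op_nth: "site_op k X $ x $ y =
    X $ (x $ k) $ (y $ k) * (\<Prod>l\<in>UNIV - {k}. mat 1 $ (x $ l) $ (y $ l))"
  by (simp add: site_op_def tensor_family_upd_nth)

lemma tensor_family_site_op: "tensor_family F ** site_op k X = tensor_family (F(k := F k ** X))"
  unfolding site_op_def tensor_family_mult by (intro arg_cong[where f=tensor_family]) auto

lemma site_op_tensor_family: "site_op k X ** tensor_family F = tensor_family (F(k := X ** F k))"
  unfolding site_op_def tensor_family_mult by (intro arg_cong[where f=tensor_family]) auto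

lemma site_op_mult: "site_op k X ** site_op k Y = site_op k (X ** Y)"
  unfolding site_op_def tensor_family_mult by (intro arg_cong[where f=tensor_family]) auto

lemma site_op_commute: "k \<noteq> l \<Longrightarrow> site_op k X ** site_op l Y = site_op l Y ** site_op k X"
  unfolding site_op_def tensor_family_mult by (intro arg_cong[where f=tensor_family]) auto

lemma sum_op_add: "sum_op (X + Y) = sum_op X + sum_op Y"
  by (simp add: sum_op_def vec_eq_iff site_op_nth sum_component sum.distrib algebra_simps)

lemma sum_op_diff: "sum_op (X - Y) = sum_op X - sum_op Y"
  by (simp add: sum_op_def vec_eq_iff site_op_nth sum_component sum_subtractf algebra_simps)

lemma sum_op_zero [simp]: "sum_op 0 = 0"
  by (simp add: sum_op_def vec_eq_iff site_op_nth sum_component)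

lemma sum_op_sum: "sum_op (\<Sum>i\<in>S. X i) = (\<Sum>i\<in>S. sum_op (X i))"
  by (induction S rule: infinite_finite_induct) (simp_all add: sum_op_add)

lemma sum_op_uminus: "sum_op (- X) = - sum_op X"
  by (simp add: sum_op_def vec_eq_iff site_op_nth sum_component sum_negf)

lemma sum_op_scale: "sum_op (cmat_scale c X) = cmat_scale c (sum_op X)"
  by (simp add: sum_op_def vec_eq_iff site_op_nth sum_component sum_distrib_left mult.assoc)

lemma mat_adj_sum_op: "mat_adj (sum_op X) = sum_op (mat_adj X)"
  unfolding sum_op_def mat_adj_sum site_op_def mat_adj_tensor_family
  by (intro sum.cong arg_cong[where f=tensor_family]) auto

text \<open>Operators at different sites commute, so only the diagonal of the double sum over sites
  survives.\<close>

lemma sum_op_commutator: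
  fixes X Y :: "'a::comm_ring_1^'i::finite^'i"
  defines "H \<equiv> sum_op :: _ \<Rightarrow> 'a^('i^'t::finite)^('i^'t)"
  shows "H X ** H Y - H Y ** H X = H (X ** Y - Y ** X)"
proof -
  have "H X ** H Y - H Y ** H X =
     (\<Sum>k\<in>UNIV. \<Sum>l\<in>UNIV. site_op k X ** site_op l Y - site_op l Y ** site_op k X)"
  proof -
    have "H Y ** H X = (\<Sum>k\<in>UNIV. \<Sum>l\<in>UNIV. site_op l Y ** site_op k X)"
      unfolding H_def sum_op_def matrix_mult_sum_left matrix_mult_sum_right by simp
    moreover have "H X ** H Y = (\<Sum>k\<in>UNIV. \<Sum>l\<in>UNIV. site_op k X ** site_op l Y)"
      unfolding H_def sum_op_def matrix_mult_sum_left matrix_mult_sum_right by (rule sum.swap)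
    ultimately show ?thesis by (simp only: sum_subtractf)
  qed
  also have "\<dots> = (\<Sum>k\<in>UNIV. \<Sum>l\<in>UNIV. if l = k then site_op k (X ** Y) - site_op k (Y ** X) else 0)"
    by (intro sum.cong refl) (auto simp: site_op_mult site_op_commute)
  also have "\<dots> = H (X ** Y - Y ** X)"
    by (simp add: H_def sum_op_diff) (simp add: H_def sum_op_def sum_subtractf)
  finally show ?thesis .
qed

section \<open>Spectral decomposition of the generators\<close>

text \<open>The Rayleigh quotient attains its maximum on the unit sphere of \<open>S\<close>. An
  invariant subspace is allowed so that the lemma can be applied again inside an eigenspace.\<close>

lemma selfadjoint_max_eigenvector:
  fixes f :: "'a::euclidean_space \<Rightarrow> 'a"
  assumes lin: "linear f" and sub: "subspace S" and inv: "\<And>x. x \<in> S \<Longrightarrow> f x \<in> S"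
    and sym: "\<And>x y. inner (f x) y = inner x (f y)"
    and x0: "x0 \<in> S" "x0 \<noteq> 0"
  obtains v a where "v \<in> S" "v \<noteq> 0" "f v = a *\<^sub>R v" "\<And>w. w \<in> S \<Longrightarrow> inner w (f w) \<le> a * (norm w)\<^sup>2"
proof -
  define K where "K = sphere 0 1 \<inter> S"
  have "compact K"
    unfolding K_def using sub by (intro compact_Int_closed compact_sphere closed_subspace)
  moreover have "x0 /\<^sub>R norm x0 \<in> K"
    using x0 sub by (auto simp: K_def subspace_scale)
  moreover have "continuous_on K (\<lambda>w. inner w (f w))"
    using lin by (intro continuous_intros linear_continuous_on) (simp add: linear_conv_bounded_linear)
  ultimately obtain v where v: "v \<in> K" and max: "\<And>w. w \<in> K \<Longrightarrow> inner w (f w) \<le> inner v (f v)"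
    using continuous_attains_sup[of K "\<lambda>w. inner w (f w)"] by blast
  define a where "a = inner v (f v)"
  have vS: "v \<in> S" and nv: "norm v = 1" using v by (auto simp: K_def)
  have bound: "inner w (f w) \<le> a * (norm w)\<^sup>2" if "w \<in> S" for w
  proof (cases "w = 0")
    case True
    then show ?thesis using linear_0[OF lin] by simp
  next
    case False
    then have "w /\<^sub>R norm w \<in> K" using that sub by (auto simp: K_def subspace_scale)
    from max[OF this] False show ?thesis
      by (simp add: linear_scale[OF lin] a_def power2_eq_square field_simps)
  qed
  define u where "u = a *\<^sub>R v - f v"
  have uS: "u \<in> S" unfolding u_def using vS sub inv by (intro subspace_diff subspace_scale)
  have uv: "inner u v = 0"
    using nv by (simp add: u_def a_def inner_diff_left inner_commute[of "f v"] norm_eq_1)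
  \<comment> \<open>The form \<open>a * norm w ^ 2 - inner w (f w)\<close> is nonnegative on \<open>S\<close> and vanishes at \<open>v\<close>,
    so \<open>v\<close> lies in its radical.\<close>
  have quad: "0 \<le> 2 * s * inner u u + s\<^sup>2 * (a * inner u u - inner u (f u))" for s
  proof -
    have "v + s *\<^sub>R u \<in> S" using vS uS sub by (simp add: subspace_add subspace_scale)
    from bound[OF this]
    have "inner (v + s *\<^sub>R u) (f (v + s *\<^sub>R u)) \<le> a * inner (v + s *\<^sub>R u) (v + s *\<^sub>R u)"
      by (simp only: power2_norm_eq_inner)
    moreover have "inner v (f u) = inner u (f v)" using sym[of u v] sym[of v u] inner_commute by metis
    moreover have "inner u (f v) = a * inner u v - inner u u"
      by (simp add: u_def algebra_simps inner_simps)
    ultimately show ?thesis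
      using uv nv by (simp add: linear_add[OF lin] linear_scale[OF lin] inner_simps a_def[symmetric]
        norm_eq_1 inner_commute[of v u] power2_eq_square algebra_simps)
  qed
  have "inner u u = 0"
  proof (rule ccontr)
    assume "inner u u \<noteq> 0"
    then have pos: "inner u u > 0" using inner_ge_zero[of u] by linarith
    define b where "b = a * inner u u - inner u (f u)"
    \<comment> \<open>A negative step, short enough that the quadratic term of \<open>quad\<close>
      cannot outweigh the linear one; the summand \<open>1\<close> covers
      \<open>b = 0\<close>.\<close>
    define s where "s = - inner u u / (1 + \<bar>b\<bar>)"
    have "s < 0" using pos by (simp add: s_def field_simps)
    have "0 \<le> s * (2 * inner u u + s * b)"
      using quad[of s] by (simp add: b_def power2_eq_square algebra_simps)
    then have "2 * inner u u + s * b \<le> 0" using \<open>s < 0\<close> by (simp add: zero_le_mult_iff)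
    moreover have "\<bar>s * b\<bar> \<le> inner u u"
      using pos by (simp add: s_def abs_mult field_simps)
    ultimately show False using pos by linarith
  qed
  then have "f v = a *\<^sub>R v" by (simp add: u_def)
  moreover have "v \<noteq> 0" using nv by auto
  ultimately show ?thesis using that vS bound by blast
qed

text \<open>For an involution \<open>P\<close> this is the projection onto the eigenvalue
  \<open>1\<close>; \<open>half_proj (- P)\<close> serves for \<open>- 1\<close>.\<close>

definition half_proj :: "complex^'i::finite^'i \<Rightarrow> complex^'i^'i" where
  "half_proj P = cmat_scale (1/2) (mat 1 + P)"

lemma half_proj_add: "half_proj P + half_proj (- P) = mat 1"
  by (simp add: half_proj_def vec_eq_iff flip: add_divide_distrib)

lemma involution_half_proj:
  assumes "P ** P = mat 1"
  shows "P ** half_proj P = half_proj P" "half_proj P ** P = half_proj P"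
    "P ** half_proj (- P) = - half_proj (- P)" "half_proj (- P) ** P = - half_proj (- P)"
  using assms
  by (simp_all add: half_proj_def cmat_scale_mult_left cmat_scale_mult_right matrix_add_ldistrib
      matrix_add_rdistrib matrix_diff_ldistrib matrix_diff_rdistrib add.commute)
     (simp_all add: vec_eq_iff diff_divide_distrib)

lemma half_proj_mult:
  assumes "P ** P = mat 1"
  shows "half_proj P ** half_proj P = half_proj P" "half_proj P ** half_proj (- P) = 0"
    "half_proj (- P) ** half_proj P = 0" "half_proj (- P) ** half_proj (- P) = half_proj (- P)"
proof -
  note d = half_proj_def[of P] half_proj_def[of "-P"]
  note s = cmat_scale_mult_left matrix_add_rdistrib matrix_diff_rdistrib matrix_mult_uminus_left involution_half_proj[OF assms]
  show "half_proj P ** half_proj P = half_proj P"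
    by (subst (1) d(1), simp add: s) (simp add: vec_eq_iff)
  show "half_proj P ** half_proj (- P) = 0"
    by (subst d(1), simp add: s)
  show "half_proj (- P) ** half_proj P = 0"
    by (subst d(2), simp add: s)
  show "half_proj (- P) ** half_proj (- P) = half_proj (- P)"
    by (subst (1) d(2), simp add: s) (simp add: vec_eq_iff)
qed

lemma mat_adj_half_proj: "mat_adj P = P \<Longrightarrow> mat_adj (half_proj P) = half_proj P"
  by (auto simp: half_proj_def vec_eq_iff mat_nth)

definition weight_proj :: "complex^'i::finite^'i \<Rightarrow> 't::finite set \<Rightarrow> complex^('i^'t)^('i^'t)" where
  "weight_proj P K = tensor_family (\<lambda>k. if k \<in> K then half_proj P else half_proj (- P))"

text \<open>The spectral projection of \<open>sum_op P\<close> for \<open>2 * j - t\<close>, with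
  \<open>t\<close> the number of sites: \<open>j\<close> sites contribute \<open>1\<close> and the
  others \<open>- 1\<close>.\<close>

definition level_proj :: "complex^'i::finite^'i \<Rightarrow> nat \<Rightarrow> complex^('i^'t::finite)^('i^'t)" where
  "level_proj P j = (\<Sum>K | card K = j. weight_proj P K)"

lemma weight_proj_mult:
  assumes "P ** P = mat 1"
  shows "weight_proj P K ** weight_proj P L = (if K = L then weight_proj P K else 0)"
proof (cases "K = L")
  case True
  then show ?thesis
    unfolding weight_proj_def tensor_family_mult
    by (simp, intro arg_cong[where f=tensor_family]) (auto simp: half_proj_mult[OF assms])
next
  case False
  then obtain k where k: "(k \<in> K) \<noteq> (k \<in> L)" by auto
  then show ?thesis
    unfolding weight_proj_def tensor_family_mult
    using False by (auto intro!: tensor_family_zero[of _ k] simp: half_proj_mult[OF assms])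
qed

text \<open>Used twice: \<open>a = b = 1\<close> gives the resolution of the identity, and
  \<open>a = exp c\<close>, \<open>b = exp (- c)\<close> the tensor power of an exponential.\<close>

lemma tensor_family_half_proj:
  "tensor_family (\<lambda>_. cmat_scale a (half_proj P) + cmat_scale b (half_proj (- P))) =
    (\<Sum>K\<in>UNIV. cmat_scale (a ^ card K * b ^ (CARD('t) - card K)) (weight_proj P (K :: 't::finite set)))"
proof -
  have "(\<Prod>k\<in>UNIV. if k \<in> K then a else b) = a ^ card K * b ^ (CARD('t) - card K)" for K :: "'t set"
  proof -
    have "(\<Prod>k\<in>UNIV. if k \<in> K then a else b) = (\<Prod>k\<in>K. a) * (\<Prod>k\<in>-K. b)"
      by (subst prod.If_cases) (auto simp: Compl_eq_Diff_UNIV)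
    then show ?thesis by (simp add: Compl_eq_Diff_UNIV card_Diff_subset)
  qed
  moreover have "(\<lambda>k. if k \<in> K then cmat_scale a (half_proj P) else cmat_scale b (half_proj (- P))) =
      (\<lambda>k. cmat_scale (if k \<in> K then a else b) (if k \<in> K then half_proj P else half_proj (- P)))"
    for K :: "'t set" by auto
  ultimately show ?thesis
    by (simp add: tensor_family_add weight_proj_def tensor_family_scale)
qed

lemma sum_weight_proj: "(\<Sum>K\<in>UNIV. weight_proj P (K :: 't::finite set)) = mat 1"
  using tensor_family_half_proj[of 1 P 1, where ?'t='t]
  by (simp add: half_proj_add tensor_family_one)

lemma mat_adj_weight_proj: "mat_adj P = P \<Longrightarrow> mat_adj (weight_proj P K) = weight_proj P K"
  unfolding weight_proj_def mat_adj_tensor_family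
  by (intro arg_cong[where f=tensor_family] ext) (auto simp: mat_adj_half_proj mat_adj_uminus)

lemma sum_op_weight_proj:
  fixes P :: "complex^'i::finite^'i" and K :: "'t::finite set"
  assumes "P ** P = mat 1"
  defines "l \<equiv> of_real (2 * real (card K) - real CARD('t))"
  shows "sum_op P ** weight_proj P K = cmat_scale l (weight_proj P K)"
    "weight_proj P K ** sum_op P = cmat_scale l (weight_proj P K)"
proof -
  define F where "F = (\<lambda>k. if k \<in> K then half_proj P else half_proj (- P))"
  define s where "s = (\<lambda>k. if k \<in> K then 1 else - 1 :: complex)"
  have W: "weight_proj P K = tensor_family F" by (simp add: weight_proj_def F_def)
  have T: "tensor_family (F(k := cmat_scale (s k) (F k))) = cmat_scale (s k) (tensor_family F)" for k
  proof -
    have "F(k := cmat_scale (s k) (F k)) = (\<lambda>l. cmat_scale (if l = k then s k else 1) (F l))" by auto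
    then show ?thesis by (simp add: tensor_family_scale)
  qed
  have "P ** F k = cmat_scale (s k) (F k)" "F k ** P = cmat_scale (s k) (F k)" for k
    by (auto simp: F_def s_def involution_half_proj[OF assms(1)])
  then have "site_op k P ** weight_proj P K = cmat_scale (s k) (weight_proj P K)"
    "weight_proj P K ** site_op k P = cmat_scale (s k) (weight_proj P K)" for k
    by (simp_all add: W tensor_family_site_op site_op_tensor_family T)
  moreover have "(\<Sum>k\<in>UNIV. s k) = l"
  proof -
    have "(\<Sum>k\<in>UNIV. s k) = of_nat (card K) - of_nat (card (- K))"
      unfolding s_def by (subst sum.If_cases) (auto simp: Compl_eq_Diff_UNIV)
    also have "of_nat (card (- K)) = of_nat CARD('t) - (of_nat (card K) :: complex)"
      by (simp add: Compl_eq_Diff_UNIV card_Diff_subset card_mono of_nat_diff)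
    finally show ?thesis by (simp add: l_def)
  qed
  moreover have "(\<Sum>k\<in>UNIV. cmat_scale (s k) A) = cmat_scale (\<Sum>k\<in>UNIV. s k) A" for A :: "complex^('i^'t)^('i^'t)"
    by (simp add: vec_eq_iff sum_component sum_distrib_right)
  ultimately show "sum_op P ** weight_proj P K = cmat_scale l (weight_proj P K)"
    "weight_proj P K ** sum_op P = cmat_scale l (weight_proj P K)"
    by (simp_all add: sum_op_def matrix_mult_sum_left matrix_mult_sum_right)
qed

lemma sum_op_level_proj:
  fixes P :: "complex^'i::finite^'i"
  assumes "P ** P = mat 1"
  defines "F \<equiv> level_proj P :: nat \<Rightarrow> complex^('i^'t::finite)^('i^'t)"
  shows "sum_op P ** F j = cmat_scale (of_real (2 * real j - real CARD('t))) (F j)"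
    "F j ** sum_op P = cmat_scale (of_real (2 * real j - real CARD('t))) (F j)"
  unfolding F_def level_proj_def
  by (auto simp: matrix_mult_sum_left matrix_mult_sum_right sum_op_weight_proj[OF assms(1)] cmat_scale_sum
      intro!: sum.cong)

lemma level_proj_mult:
  assumes "P ** P = mat 1"
  shows "level_proj P i ** level_proj P j = (if i = j then level_proj P i else 0)"
  unfolding level_proj_def matrix_mult_sum_left matrix_mult_sum_right weight_proj_mult[OF assms]
  by (auto simp: sum.delta' intro!: sum.neutral sum.cong)

lemma sum_level_proj:
  "(\<Sum>j\<le>CARD('t). level_proj P j) = (mat 1 :: complex^('i::finite^'t::finite)^('i^'t))"
proof -
  have "(\<Sum>j\<le>CARD('t). level_proj P j) = (\<Sum>K\<in>UNIV. weight_proj P (K :: 't set))"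
    unfolding level_proj_def using sum.group[of "UNIV :: 't set set" "{..CARD('t)}" card "weight_proj P"]
    by (simp add: image_subset_iff card_mono)
  then show ?thesis by (simp add: sum_weight_proj)
qed

lemma mat_adj_level_proj: "mat_adj P = P \<Longrightarrow> mat_adj (level_proj P j) = level_proj P j"
  by (simp add: level_proj_def mat_adj_sum mat_adj_weight_proj)

text \<open>Evaluating \<open>sum_op P\<close> on either side of a block
  \<open>F i ** B ** F j\<close> gives two different eigenvalues unless \<open>i = j\<close>. With
  the off-diagonal blocks zero, both products equal \<open>F j ** B ** F j\<close>.\<close>

lemma commute_level_proj:
  fixes P :: "complex^'i::finite^'i" and B :: "complex^('i^'t::finite)^('i^'t)"
  assumes P: "P ** P = mat 1" and B: "B ** sum_op P = sum_op P ** B"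
  shows "B ** level_proj P j = level_proj P j ** B"
proof -
  define F where "F = (level_proj P :: nat \<Rightarrow> complex^('i^'t)^('i^'t))"
  have zero: "F i ** B ** F j = 0" if "i \<noteq> j" for i j
  proof -
    have "cmat_scale (of_real (2 * real i - real CARD('t))) (F i ** B ** F j) = F i ** sum_op P ** B ** F j"
      by (simp add: F_def sum_op_level_proj[OF P] cmat_scale_mult_left)
    also have "\<dots> = F i ** B ** (sum_op P ** F j)"
      by (metis B matrix_mul_assoc)
    also have "\<dots> = cmat_scale (of_real (2 * real j - real CARD('t))) (F i ** B ** F j)"
      by (simp add: F_def sum_op_level_proj[OF P] cmat_scale_mult_right)
    finally have "of_real (2 * real i - real CARD('t)) * (F i ** B ** F j) $ x $ y =
        of_real (2 * real j - real CARD('t)) * (F i ** B ** F j) $ x $ y" for x y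
      by (metis cmat_scale_nth)
    then show ?thesis using that by (auto simp: vec_eq_iff simp flip: of_real_mult)
  qed
  have FF: "F j ** F i = (if i = j then F i else 0)" for i j
    by (simp add: F_def level_proj_mult[OF P])
  show ?thesis
  proof (cases "j \<le> CARD('t)")
    case True
    have "B ** F j = (\<Sum>i\<le>CARD('t). F i ** (B ** F j))"
      using sum_level_proj[of P, where ?'t='t] by (simp flip: matrix_mult_sum_left F_def)
    also have "\<dots> = (\<Sum>i\<le>CARD('t). if i = j then F j ** B ** F j else 0)"
      using zero by (intro sum.cong) (auto simp: matrix_mul_assoc)
    also have "\<dots> = F j ** B ** F j" using True by simp
    also have "\<dots> = (\<Sum>i\<le>CARD('t). if i = j then F j ** B ** F i else 0)" using True by simp
    also have "\<dots> = (\<Sum>i\<le>CARD('t). (F j ** B) ** F i)"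
      using zero by (intro sum.cong) auto
    also have "\<dots> = F j ** B"
      using sum_level_proj[of P, where ?'t='t] by (simp flip: matrix_mult_sum_right F_def)
    finally show ?thesis by (simp add: F_def)
  next
    case False
    then have "{K :: 't set. card K = j} = {}" using card_mono[of "UNIV :: 't set"] by auto
    then show ?thesis by (simp add: level_proj_def)
  qed
qed

lemma level_proj_norm:
  fixes P :: "complex^'i::finite^'i" and v :: "complex^('i^'t::finite)"
  assumes P: "P ** P = mat 1" and adj: "mat_adj P = P"
  shows "inner v (level_proj P j *v v) = (norm (level_proj P j *v v))\<^sup>2" (is ?A)
    and "(norm v)\<^sup>2 = (\<Sum>j\<le>CARD('t). (norm (level_proj P j *v v))\<^sup>2)" (is ?B)
    and "(norm (sum_op P *v v))\<^sup>2 =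
      (\<Sum>j\<le>CARD('t). (2 * real j - real CARD('t))\<^sup>2 * (norm (level_proj P j *v v))\<^sup>2)" (is ?C)
proof -
  have *: "inner u (level_proj P j *v u) = (norm (level_proj P j *v u))\<^sup>2" for j and u :: "complex^('i^'t)"
    by (metis P adj inner_hermitian level_proj_mult mat_adj_level_proj matrix_vector_mul_assoc power2_norm_eq_inner)
  then show ?A .
  have **: "(norm u)\<^sup>2 = (\<Sum>j\<le>CARD('t). (norm (level_proj P j *v u))\<^sup>2)" for u :: "complex^('i^'t)"
  proof -
    have "(norm u)\<^sup>2 = inner u (mat 1 *v u)" by (simp add: power2_norm_eq_inner)
    also have "\<dots> = (\<Sum>j\<le>CARD('t). inner u (level_proj P j *v u))"
      by (simp flip: sum_level_proj[of P] add: matrix_vector_mult_sum_left inner_sum_right)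
    finally show ?thesis by (simp add: *)
  qed
  then show ?B .
  have "level_proj P j *v (sum_op P *v v) = (2 * real j - real CARD('t)) *\<^sub>R (level_proj P j *v v)" for j
    by (simp add: matrix_vector_mul_assoc sum_op_level_proj[OF P] cmat_scale_vector scaleR_eq_vector_smult)
  then show ?C by (subst **) (simp add: power_mult_distrib)
qed

section \<open>Frames of antisymmetric involutions and their Casimir operator\<close>

text \<open>The projection onto the kernel of \<open>sum_op P\<close>. The eigenvalue
  \<open>2 * j - t\<close> vanishes only for \<open>j = t / 2\<close>, so for odd \<open>t\<close>
  the kernel is trivial.\<close>

definition zero_proj :: "complex^'i::finite^'i \<Rightarrow> complex^('i^'t::finite)^('i^'t)" where
  "zero_proj P = (if even CARD('t) then level_proj P (CARD('t) div 2) else 0)"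

lemma mat_adj_zero_proj: "mat_adj P = P \<Longrightarrow> mat_adj (zero_proj P) = zero_proj P"
  by (simp add: zero_proj_def mat_adj_level_proj) (simp add: vec_eq_iff)

text \<open>The form as a sum over levels permits a term-by-term comparison with the third part of
  \<open>level_proj_norm\<close>.\<close>

lemma zero_proj_defect:
  fixes P :: "complex^'i::finite^'i" and v :: "complex^('i^'t::finite)"
  assumes P: "P ** P = mat 1" and adj: "mat_adj P = P"
  shows "(norm v)\<^sup>2 - inner v (zero_proj P *v v) =
    (\<Sum>j\<le>CARD('t). (if 2 * j = CARD('t) then 0 else (norm (level_proj P j *v v))\<^sup>2))"
proof -
  have "inner v (zero_proj P *v v) =
      (\<Sum>j\<le>CARD('t). (if 2 * j = CARD('t) then (norm (level_proj P j *v v))\<^sup>2 else 0))"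
  proof (cases "even CARD('t)")
    case True
    then have "2 * j = CARD('t) \<longleftrightarrow> j = CARD('t) div 2" for j by auto
    then show ?thesis using True
      by (simp add: zero_proj_def level_proj_norm(1)[OF P adj])
  next
    case False
    then have "2 * j \<noteq> CARD('t)" for j by (metis dvd_triv_left)
    then show ?thesis using False by (simp add: zero_proj_def)
  qed
  then show ?thesis
    by (simp add: level_proj_norm(2)[OF P adj, of v] flip: sum_subtractf) (auto intro!: sum.cong)
qed

text \<open>\<open>completeness\<close> says that the frame resolves the projection onto
  antisymmetric matrices up to a constant; counting both signs of each element makes this constant N
  rather than N / 2.\<close>

locale antisymmetric_frame =
  fixes Z :: "(complex^'i::finite^'i) set"
  assumes finite_frame: "finite Z"
    and involution: "P \<in> Z \<Longrightarrow> P ** P = mat 1"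
    and hermitian: "P \<in> Z \<Longrightarrow> mat_adj P = P"
    and antisymmetric: "P \<in> Z \<Longrightarrow> P $ j $ i = - P $ i $ j"
    and uminus_closed: "P \<in> Z \<Longrightarrow> - P \<in> Z"
    and commute_or_anticommute: "P \<in> Z \<Longrightarrow> Q \<in> Z \<Longrightarrow> P ** Q = Q ** P \<or> P ** Q = - (Q ** P)"
    and mult_closed: "P \<in> Z \<Longrightarrow> Q \<in> Z \<Longrightarrow> P ** Q = - (Q ** P) \<Longrightarrow> cmat_scale \<i> (P ** Q) \<in> Z"
    and completeness: "(\<Sum>P\<in>Z. P $ i $ j * P $ k $ l) =
      of_nat CARD('i) * ((if i = l \<and> j = k then 1 else 0) - (if i = k \<and> j = l then 1 else 0))"
begin

text \<open>One diagonal entry of the sum of all \<open>P ** P\<close> is computed twice, from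
  \<open>involution\<close> and from \<open>completeness\<close>.\<close>

lemma card_frame: "real (card Z) = real CARD('i) * (real CARD('i) - 1)"
proof -
  obtain i :: 'i where True by simp
  have "(\<Sum>P\<in>Z. (P ** P) $ i $ i) = (\<Sum>j\<in>UNIV. \<Sum>P\<in>Z. P $ i $ j * P $ j $ i)"
    unfolding matrix_mult_nth by (rule sum.swap)
  also have "\<dots> = (\<Sum>j\<in>UNIV. of_nat CARD('i) * (1 - (if i = j then 1 else 0)))"
    by (intro sum.cong refl) (simp add: completeness)
  also have "\<dots> = of_nat CARD('i) * (of_nat CARD('i) - (1::complex))"
    by (simp add: sum_subtractf flip: sum_distrib_left)
  also have "(\<Sum>P\<in>Z. (P ** P) $ i $ i) = of_nat (card Z)"
    by (simp add: involution mat_nth)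
  finally have "complex_of_real (real (card Z)) = of_real (real CARD('i) * (real CARD('i) - 1))"
    by simp
  then show ?thesis by (simp only: of_real_eq_iff)
qed

definition anticommuting :: "complex^'i^'i \<Rightarrow> (complex^'i^'i) set" where
  "anticommuting J = {P \<in> Z. J ** P = - (P ** J)}"

text \<open>For anticommuting \<open>J\<close> and \<open>P\<close> the three matrices
  \<open>J\<close>, \<open>P\<close>, \<open>partner J P\<close> span a copy of su(2); the factor
  \<open>\<i>\<close> keeps the product Hermitian.\<close>

definition partner :: "complex^'i^'i \<Rightarrow> complex^'i^'i \<Rightarrow> complex^'i^'i" where
  "partner J P = cmat_scale \<i> (J ** P)"

lemma frame_nonzero: "P \<in> Z \<Longrightarrow> P \<noteq> 0"
proof
  assume "P \<in> Z" "P = 0"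
  then have "mat 1 = (0 :: complex^'i^'i)" using involution[of P] by simp
  then have "(mat 1 :: complex^'i^'i) $ i $ i = 0" for i by simp
  then show False by (simp add: mat_nth)
qed

text \<open>The sum of all \<open>P ** J ** P\<close> equals N J by \<open>completeness\<close>,
  while conjugation by \<open>P\<close> only changes the sign of \<open>J\<close>, precisely when
  \<open>P\<close> anticommutes with it. So commuting elements outnumber anticommuting ones by
  N.\<close>

lemma card_anticommuting:
  assumes J: "J \<in> Z"
  shows "real (card (anticommuting J)) = real CARD('i) * (real CARD('i) - 2) / 2"
proof -
  let ?A = "anticommuting J"
  have AZ: "?A \<subseteq> Z" by (auto simp: anticommuting_def)
  obtain i l where il: "J $ i $ l \<noteq> 0"
    using frame_nonzero[OF J] by (auto simp: vec_eq_iff)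
  \<comment> \<open>This removes the trace part that \<open>completeness\<close> would
    produce.\<close>
  have diag: "J $ j $ j = 0" for j
    using antisymmetric[OF J, of j j] by simp
  have conj: "P ** J ** P = (if P \<in> ?A then - J else J)" if "P \<in> Z" for P
  proof (cases "P \<in> ?A")
    case True
    then have "P ** J = - (J ** P)" by (simp add: anticommuting_def)
    then show ?thesis
      using True by (simp add: matrix_mult_uminus_left involution[OF that] flip: matrix_mul_assoc)
  next
    case False
    then have "P ** J = J ** P"
      using commute_or_anticommute[OF J that] that by (auto simp: anticommuting_def)
    then show ?thesis
      using False by (simp add: involution[OF that] flip: matrix_mul_assoc)
  qed
  have "(\<Sum>P\<in>Z. (P ** J ** P) $ i $ l) = (\<Sum>P\<in>Z. \<Sum>k\<in>UNIV. \<Sum>j\<in>UNIV. J $ j $ k * (P $ i $ j * P $ k $ l))"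
    unfolding matrix_mult_nth sum_distrib_right by (intro sum.cong refl) (simp add: mult_ac)
  also have "\<dots> = (\<Sum>k\<in>UNIV. \<Sum>P\<in>Z. \<Sum>j\<in>UNIV. J $ j $ k * (P $ i $ j * P $ k $ l))"
    by (rule sum.swap)
  also have "\<dots> = (\<Sum>k\<in>UNIV. \<Sum>j\<in>UNIV. J $ j $ k * (\<Sum>P\<in>Z. P $ i $ j * P $ k $ l))"
    unfolding sum_distrib_left by (rule sum.cong[OF refl]) (rule sum.swap)
  also have "\<dots> = (\<Sum>k\<in>UNIV. \<Sum>j\<in>UNIV. - (if i = k then (if j = l then of_nat CARD('i) * J $ j $ k else 0) else 0))"
  proof (intro sum.cong refl)
    fix k j
    show "J $ j $ k * (\<Sum>P\<in>Z. P $ i $ j * P $ k $ l) =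
        - (if i = k then (if j = l then of_nat CARD('i) * J $ j $ k else 0) else 0)"
      unfolding completeness by (cases "j = k"; cases "i = k"; cases "j = l"; simp add: diag)
  qed
  also have "\<dots> = - (of_nat CARD('i) * J $ l $ i)"
    by (simp add: sum_negf sum.If_cases)
  also have "\<dots> = of_nat CARD('i) * J $ i $ l"
    using antisymmetric[OF J, of l i] by simp
  finally have 1: "(\<Sum>P\<in>Z. (P ** J ** P) $ i $ l) = of_nat CARD('i) * J $ i $ l" .
  have "(\<Sum>P\<in>Z. (P ** J ** P) $ i $ l) = (\<Sum>P\<in>Z. if P \<in> ?A then - J $ i $ l else J $ i $ l)"
    by (intro sum.cong refl) (auto simp: conj)
  also have "\<dots> = (of_nat (card (Z - ?A)) - of_nat (card ?A)) * J $ i $ l"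
    using AZ finite_frame by (simp add: sum.If_cases Int_absorb1 Diff_eq algebra_simps)
  finally have "of_nat (card (Z - ?A)) - of_nat (card ?A) = (of_nat CARD('i) :: complex)"
    using 1 il by simp
  then have "complex_of_real (real (card (Z - ?A)) - real (card ?A)) = of_real (real CARD('i))"
    by simp
  then have "real (card (Z - ?A)) - real (card ?A) = real CARD('i)"
    by (simp only: of_real_eq_iff)
  moreover have "real (card (Z - ?A)) = real (card Z) - real (card ?A)"
    using AZ finite_frame by (simp add: card_Diff_subset finite_subset card_mono of_nat_diff)
  ultimately show ?thesis using card_frame by (simp add: algebra_simps)
qed

lemma partner_mult:
  assumes "J \<in> Z" "P \<in> anticommuting J"
  shows "J ** partner J P = cmat_scale \<i> P" "partner J P ** J = cmat_scale (- \<i>) P"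
    "P ** partner J P = cmat_scale (- \<i>) J" "partner J P ** P = cmat_scale \<i> J"
proof -
  have P: "P \<in> Z" "J ** P = - (P ** J)" and PJ: "P ** J = - (J ** P)"
    using assms(2) by (simp_all add: anticommuting_def)
  show "J ** partner J P = cmat_scale \<i> P"
    by (simp add: partner_def cmat_scale_mult_right matrix_mul_assoc involution[OF assms(1)])
  show "partner J P ** P = cmat_scale \<i> J"
    by (simp add: partner_def cmat_scale_mult_left involution[OF P(1)] flip: matrix_mul_assoc)
  show "partner J P ** J = cmat_scale (- \<i>) P"
    by (simp add: partner_def cmat_scale_mult_left PJ matrix_mult_uminus_right matrix_mul_assoc
      involution[OF assms(1)] cmat_scale_uminus flip: matrix_mul_assoc)
      (simp add: matrix_mul_assoc involution[OF assms(1)])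
  show "P ** partner J P = cmat_scale (- \<i>) J"
    by (simp add: partner_def cmat_scale_mult_right P(2) matrix_mult_uminus_right matrix_mul_assoc
      involution[OF P(1)] cmat_scale_uminus)
qed

lemma partner_anticommuting:
  assumes "J \<in> Z" "P \<in> anticommuting J"
  shows "partner J P \<in> anticommuting J"
  using mult_closed[OF assms(1), of P] assms(2) partner_mult[OF assms]
  by (auto simp: anticommuting_def partner_def vec_eq_iff)

lemma partner_partner:
  assumes "J \<in> Z"
  shows "partner J (partner J P) = - P"
  by (simp add: partner_def cmat_scale_mult_right matrix_mul_assoc involution[OF assms])

lemma uminus_anticommuting: "P \<in> anticommuting J \<Longrightarrow> - P \<in> anticommuting J"
  by (simp add: anticommuting_def uminus_closed matrix_mult_uminus_left matrix_mult_uminus_right)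

lemma partner_uminus: "partner J (- P) = - partner J P"
  by (simp add: partner_def matrix_mult_uminus_right vec_eq_iff)

text \<open>Applying \<open>partner J\<close> twice gives \<open>- P\<close>, so the inverse is the
  negated partner; it stays in the frame because of \<open>uminus_closed\<close>.\<close>

lemma bij_betw_partner:
  assumes "J \<in> Z"
  shows "bij_betw (partner J) (anticommuting J) (anticommuting J)"
  by (rule bij_betw_byWitness[where f' = "\<lambda>P. - partner J P"])
     (auto simp: partner_partner assms partner_uminus partner_anticommuting uminus_anticommuting)

lemma sum_op_partner_commutator:
  assumes "J \<in> Z" "P \<in> anticommuting J"
  defines "H \<equiv> sum_op :: complex^'i^'i \<Rightarrow> complex^('i^'t::finite)^('i^'t)"
  shows "H J ** H P - H P ** H J = cmat_scale (- 2 * \<i>) (H (partner J P))"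
    "H J ** H (partner J P) - H (partner J P) ** H J = cmat_scale (2 * \<i>) (H P)"
    "H P ** H (partner J P) - H (partner J P) ** H P = cmat_scale (- 2 * \<i>) (H J)"
proof -
  have "P ** J = - (J ** P)" using assms(2) by (simp add: anticommuting_def)
  then have "J ** P - P ** J = cmat_scale (- 2 * \<i>) (partner J P)"
    by (simp add: partner_def vec_eq_iff)
  then show "H J ** H P - H P ** H J = cmat_scale (- 2 * \<i>) (H (partner J P))"
    by (simp add: H_def sum_op_commutator sum_op_scale)
  have "J ** partner J P - partner J P ** J = cmat_scale (2 * \<i>) P"
    by (simp add: partner_mult[OF assms(1,2)] vec_eq_iff)
  then show "H J ** H (partner J P) - H (partner J P) ** H J = cmat_scale (2 * \<i>) (H P)"
    by (simp add: H_def sum_op_commutator sum_op_scale)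
  have "P ** partner J P - partner J P ** P = cmat_scale (- 2 * \<i>) J"
    by (simp add: partner_mult[OF assms(1,2)] vec_eq_iff)
  then show "H P ** H (partner J P) - H (partner J P) ** H P = cmat_scale (- 2 * \<i>) (H J)"
    by (simp add: H_def sum_op_commutator sum_op_scale)
qed

definition casimir :: "complex^('i^'t::finite)^('i^'t)" where
  "casimir = (\<Sum>P\<in>Z. sum_op P ** sum_op P)"

text \<open>The commutator of \<open>sum_op Q\<close> with the square of \<open>sum_op P\<close> is
  a multiple of the symmetrised product \<open>T P\<close>. Reindexing by \<open>partner Q\<close>,
  which squares to minus the identity, turns the sum of \<open>T\<close> into its negative.\<close>

lemma casimir_commute:
  assumes Q: "Q \<in> Z"
  shows "sum_op Q ** casimir = (casimir ** sum_op Q :: complex^('i^'t::finite)^('i^'t))"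
proof -
  let ?H = "sum_op :: complex^'i^'i \<Rightarrow> complex^('i^'t)^('i^'t)"
  let ?A = "anticommuting Q"
  define T where "T P = ?H (partner Q P) ** ?H P + ?H P ** ?H (partner Q P)" for P
  have D: "?H Q ** (?H P ** ?H P) - (?H P ** ?H P) ** ?H Q =
      (if P \<in> ?A then cmat_scale (- 2 * \<i>) (T P) else 0)" if P: "P \<in> Z" for P
  proof -
    have "?H Q ** (?H P ** ?H P) - (?H P ** ?H P) ** ?H Q =
        (?H Q ** ?H P - ?H P ** ?H Q) ** ?H P + ?H P ** (?H Q ** ?H P - ?H P ** ?H Q)"
      by (simp add: matrix_diff_ldistrib matrix_diff_rdistrib matrix_mul_assoc)
    moreover have "?H Q ** ?H P - ?H P ** ?H Q = (if P \<in> ?A then cmat_scale (- 2 * \<i>) (?H (partner Q P)) else 0)"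
    proof (cases "P \<in> ?A")
      case True
      then show ?thesis using sum_op_partner_commutator(1)[OF Q] by auto
    next
      case False
      then have "Q ** P = P ** Q"
        using commute_or_anticommute[OF Q P] P by (auto simp: anticommuting_def)
      then show ?thesis using False by (simp add: sum_op_commutator)
    qed
    ultimately show ?thesis
      by (simp add: T_def cmat_scale_mult_left cmat_scale_mult_right cmat_scale_add)
  qed
  have AZ: "?A \<subseteq> Z" by (auto simp: anticommuting_def)
  have "(\<Sum>P\<in>?A. T P) = (\<Sum>P\<in>?A. T (partner Q P))"
    using sum.reindex_bij_betw[OF bij_betw_partner[OF Q], of T] by simp
  also have "\<dots> = - (\<Sum>P\<in>?A. T P)"
    unfolding sum_negf[symmetric] T_def
    by (intro sum.cong refl) (simp add: partner_partner[OF Q] sum_op_uminus matrix_mult_uminus_left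
        matrix_mult_uminus_right)
  finally have T0: "(\<Sum>P\<in>?A. T P) = 0"
    by (simp add: vec_eq_iff)
  have "?H Q ** casimir - casimir ** ?H Q = (\<Sum>P\<in>Z. ?H Q ** (?H P ** ?H P) - (?H P ** ?H P) ** ?H Q)"
    by (simp add: casimir_def matrix_mult_sum_left matrix_mult_sum_right sum_subtractf)
  also have "\<dots> = (\<Sum>P\<in>Z. if P \<in> ?A then cmat_scale (- 2 * \<i>) (T P) else 0)"
    by (intro sum.cong D refl)
  also have "\<dots> = (\<Sum>P\<in>?A. cmat_scale (- 2 * \<i>) (T P))"
    using AZ finite_frame by (simp add: sum.If_cases Int_absorb1)
  also have "\<dots> = 0" using T0 by (simp flip: cmat_scale_sum)
  finally show ?thesis by simp
qed

lemma mat_adj_casimir: "mat_adj casimir = casimir"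
  by (simp add: casimir_def mat_adj_sum mat_adj_mult mat_adj_sum_op hermitian)

lemma inner_casimir: "inner w (casimir *v w) = (\<Sum>P\<in>Z. (norm (sum_op P *v w))\<^sup>2)"
proof -
  have "inner w ((sum_op P ** sum_op P) *v w) = (norm (sum_op P *v w))\<^sup>2" if "P \<in> Z" for P
    using inner_hermitian[of "sum_op P" w "sum_op P *v w"] hermitian[OF that]
    by (simp add: mat_adj_sum_op matrix_vector_mul_assoc power2_norm_eq_inner)
  then show ?thesis
    by (simp add: casimir_def matrix_vector_mult_sum_left inner_sum_right)
qed

end

section \<open>The spectral gap\<close>

text \<open>Some level component of \<open>u\<close> is nonzero and identifies \<open>l\<close>.
  This makes the set of weights finite and bounds it by the number of factors.\<close>

lemma sum_op_eigenvalue_level: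
  fixes P :: "complex^'i::finite^'i" and u :: "complex^('i^'t::finite)"
  assumes P: "P ** P = mat 1" and adj: "mat_adj P = P" and u: "u \<noteq> 0" "sum_op P *v u = l *\<^sub>R u"
  shows "\<exists>j\<le>CARD('t). l = 2 * real j - real CARD('t)"
proof -
  have "(\<Sum>j\<le>CARD('t). (norm (level_proj P j *v u))\<^sup>2) \<noteq> 0"
    using u(1) by (simp flip: level_proj_norm(2)[OF P adj])
  then obtain j where j: "j \<le> CARD('t)" "level_proj P j *v u \<noteq> 0"
    by (metis (mono_tags, lifting) atMost_iff norm_zero power_zero_numeral sum.neutral)
  have "(2 * real j - real CARD('t)) *\<^sub>R (level_proj P j *v u) = (level_proj P j ** sum_op P) *v u"
    by (simp add: sum_op_level_proj[OF P] cmat_scale_vector scaleR_eq_vector_smult)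
  also have "\<dots> = l *\<^sub>R (level_proj P j *v u)"
    by (simp add: u(2) complex_matrix_vector_scaleR flip: matrix_vector_mul_assoc)
  finally show ?thesis using j by auto
qed

context antisymmetric_frame
begin

text \<open>The combinations \<open>P - i * partner J P\<close> shift the weights of \<open>J\<close> by two, as in
  the representation theory of \<open>su(2)\<close>, and so annihilate a vector of maximal weight.\<close>

lemma raising_eq_zero:
  fixes w :: "complex^('i^'t::finite)"
  assumes J: "J \<in> Z" and P: "P \<in> anticommuting J"
    and cas: "casimir *v w = c *\<^sub>R w" and w: "sum_op J *v w = m *\<^sub>R w"
    and max: "\<And>u :: complex^('i^'t). casimir *v u = c *\<^sub>R u \<Longrightarrow> sum_op J *v u = (m + 2) *\<^sub>R u \<Longrightarrow> u = 0"
  shows "(norm (sum_op P *v w))\<^sup>2 + (norm (sum_op (partner J P) *v w))\<^sup>2 = 2 * m * (norm w)\<^sup>2"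
proof -
  let ?H = "\<lambda>P. (*v) (sum_op P :: complex^('i^'t)^('i^'t))"
  let ?R = "partner J P"
  have PZ: "P \<in> Z" using P by (simp add: anticommuting_def)
  have RZ: "?R \<in> Z" using partner_anticommuting[OF J P] by (simp add: anticommuting_def)
  have c1: "?H J (?H P x) = ?H P (?H J x) - (2 * \<i>) *s ?H ?R x"
    and c2: "?H J (?H ?R x) = ?H ?R (?H J x) + (2 * \<i>) *s ?H P x"
    and c3: "?H P (?H ?R x) = ?H ?R (?H P x) - (2 * \<i>) *s ?H J x" for x
  proof -
    have "?H J (?H P x) - ?H P (?H J x) = (- 2 * \<i>) *s ?H ?R x"
      "?H J (?H ?R x) - ?H ?R (?H J x) = (2 * \<i>) *s ?H P x"
      "?H P (?H ?R x) - ?H ?R (?H P x) = (- 2 * \<i>) *s ?H J x"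
      using sum_op_partner_commutator[OF J P, where ?'t = 't]
      by (simp_all add: matrix_vector_mul_assoc cmat_scale_vector flip: matrix_vector_mult_diff_rdistrib)
    then show "?H J (?H P x) = ?H P (?H J x) - (2 * \<i>) *s ?H ?R x"
      "?H J (?H ?R x) = ?H ?R (?H J x) + (2 * \<i>) *s ?H P x"
      "?H P (?H ?R x) = ?H ?R (?H P x) - (2 * \<i>) *s ?H J x"
      by (simp_all add: algebra_simps vec_eq_iff)
  qed
  define u where "u = ?H P w - \<i> *s ?H ?R w"
  have "casimir *v u = c *\<^sub>R u"
  proof -
    have "casimir *v ?H Q w = c *\<^sub>R ?H Q w" if "Q \<in> Z" for Q
      by (rule commuting_eigenspace[OF casimir_commute[OF that] cas])
    then show ?thesis
      by (simp add: u_def matrix_vector_mult_diff_distrib matrix_vector_smult PZ RZ scaleR_diff_right)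
        (simp add: vec_eq_iff)
  qed
  moreover have "sum_op J *v u = (m + 2) *\<^sub>R u"
    by (simp add: u_def matrix_vector_mult_diff_distrib matrix_vector_smult c1 c2 w
        complex_matrix_vector_scaleR)
      (simp add: vec_eq_iff algebra_simps scaleR_conv_of_real[where 'a=complex])
  ultimately have "u = 0" by (rule max)
  then have PR: "?H P w = \<i> *s ?H ?R w" by (simp add: u_def)
  \<comment> \<open>Inserting \<open>PR\<close> once in each square turns their sum into
    \<open>\<i>\<close> times the commutator of \<open>?H P\<close> and \<open>?H ?R\<close>, hence
    into a multiple of \<open>?H J w\<close>.\<close>
  have "?H P (?H P w) = \<i> *s ?H P (?H ?R w)"
    by (subst PR) (simp add: matrix_vector_smult)
  moreover have "?H ?R (?H P w) = \<i> *s ?H ?R (?H ?R w)"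
    by (subst PR) (simp add: matrix_vector_smult)
  then have "?H ?R (?H ?R w) = - (\<i> *s ?H ?R (?H P w))"
    by (simp add: smult_ii)
  ultimately have "?H P (?H P w) + ?H ?R (?H ?R w) = (2 * m) *\<^sub>R w"
    using c3[of w] by (simp add: vector_smult_diff w)
      (simp add: vec_eq_iff scaleR_conv_of_real[where 'a=complex])
  moreover have "inner w (?H Q (?H Q w)) = (norm (?H Q w))\<^sup>2" if "Q \<in> Z" for Q
    using inner_hermitian[of "sum_op Q" w "sum_op Q *v w"] hermitian[OF that]
    by (simp add: mat_adj_sum_op power2_norm_eq_inner)
  ultimately show ?thesis
    using PZ RZ inner_add_right[of w "?H P (?H P w)" "?H ?R (?H ?R w)"]
    by (simp add: power2_norm_eq_inner)
qed

text \<open>The anticommuting elements are evaluated exactly; of the remaining ones only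
  \<open>J\<close> and \<open>- J\<close> are kept, the others contributing nonnegative
  terms.\<close>

lemma casimir_lower_bound:
  fixes w :: "complex^('i^'t::finite)"
  assumes J: "J \<in> Z" and w0: "w \<noteq> 0" and m: "m \<ge> 0"
    and cas: "casimir *v w = c *\<^sub>R w" and w: "sum_op J *v w = m *\<^sub>R w"
    and max: "\<And>u :: complex^('i^'t). casimir *v u = c *\<^sub>R u \<Longrightarrow> sum_op J *v u = (m + 2) *\<^sub>R u \<Longrightarrow> u = 0"
  shows "c \<ge> 2 * m\<^sup>2 + m * (real CARD('i) * (real CARD('i) - 2) / 2)"
proof -
  let ?A = "anticommuting J"
  define f where "f P = (norm (sum_op P *v w))\<^sup>2" for P
  have A: "?A \<subseteq> Z" "finite ?A"
    using finite_frame by (auto simp: anticommuting_def)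
  \<comment> \<open>As partnering permutes \<open>?A\<close>, summing the pair identity over all of
    \<open>?A\<close> counts every element twice.\<close>
  have "2 * (\<Sum>P\<in>?A. f P) = (\<Sum>P\<in>?A. f P) + (\<Sum>P\<in>?A. f (partner J P))"
    using sum.reindex_bij_betw[OF bij_betw_partner[OF J], of f] by simp
  also have "\<dots> = (\<Sum>P\<in>?A. 2 * m * (norm w)\<^sup>2)"
    unfolding sum.distrib[symmetric] f_def
    by (intro sum.cong refl raising_eq_zero[OF J _ cas w max])
  finally have 1: "(\<Sum>P\<in>?A. f P) = m * (real CARD('i) * (real CARD('i) - 2) / 2) * (norm w)\<^sup>2"
    by (simp add: card_anticommuting[OF J] algebra_simps)
  have ne: "J \<noteq> - J"
    using frame_nonzero[OF J] by (auto simp: vec_eq_iff)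
  have "J ** J \<noteq> - (J ** J)"
    unfolding involution[OF J] by (auto simp: vec_eq_iff mat_nth)
  then have sub: "{J, - J} \<subseteq> Z - ?A"
    using J uminus_closed[OF J]
    by (auto simp: anticommuting_def matrix_mult_uminus_left matrix_mult_uminus_right)
  have "f J = m\<^sup>2 * (norm w)\<^sup>2" "f (- J) = m\<^sup>2 * (norm w)\<^sup>2"
    by (simp_all add: f_def sum_op_uminus matrix_vector_uminus w power_mult_distrib)
  then have "2 * m\<^sup>2 * (norm w)\<^sup>2 = (\<Sum>P\<in>{J, - J}. f P)"
    using ne by simp
  also have "\<dots> \<le> (\<Sum>P\<in>Z - ?A. f P)"
    using finite_frame sub by (intro sum_mono2) (auto simp: f_def)
  finally have 2: "2 * m\<^sup>2 * (norm w)\<^sup>2 \<le> (\<Sum>P\<in>Z - ?A. f P)" .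
  have "c * (norm w)\<^sup>2 = inner w (casimir *v w)"
    by (simp add: cas power2_norm_eq_inner)
  also have "\<dots> = (\<Sum>P\<in>Z. f P)" by (simp add: inner_casimir f_def)
  also have "\<dots> = (\<Sum>P\<in>Z - ?A. f P) + (\<Sum>P\<in>?A. f P)"
    using A finite_frame by (intro sum.subset_diff)
  finally have "(2 * m\<^sup>2 + m * (real CARD('i) * (real CARD('i) - 2) / 2)) * (norm w)\<^sup>2 \<le> c * (norm w)\<^sup>2"
    using 1 2 by (simp add: algebra_simps)
  then show ?thesis using w0 by simp
qed

lemma zero_proj_gap:
  fixes v :: "complex^('i^'t::finite)"
  assumes v: "v \<noteq> 0" and cas: "casimir *v v = c *\<^sub>R v"
    and moved: "\<exists>P\<in>Z. sum_op P *v v \<noteq> 0" and N: "CARD('i) \<ge> 2"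
  shows "(\<Sum>P\<in>Z. (norm v)\<^sup>2 - inner v (zero_proj P *v v)) \<ge>
    (2 + real CARD('i) * (real CARD('i) - 2) / (2 * real CARD('t))) * (norm v)\<^sup>2"
proof -
  define L where "L j = 2 * real j - real CARD('t)" for j
  \<comment> \<open>The weights of all frame elements on the whole \<open>c\<close>-eigenspace, not
    just those occurring in \<open>v\<close>: a raised vector stays in this eigenspace, so the
    maximum cannot be exceeded. The maximising \<open>J\<close> and \<open>w\<close> need have no
    relation to \<open>v\<close>.\<close>
  define W where "W = {l. \<exists>P\<in>Z. \<exists>u :: complex^('i^'t). u \<noteq> 0 \<and> casimir *v u = c *\<^sub>R u \<and> sum_op P *v u = l *\<^sub>R u}"
  define m where "m = Max W"
  have W_sub: "W \<subseteq> L ` {..CARD('t)}"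
    using sum_op_eigenvalue_level[OF involution hermitian] by (fastforce simp: W_def L_def)
  then have fin: "finite W" by (rule finite_subset) simp
  have level: "L j \<in> W" if "P \<in> Z" "level_proj P j *v v \<noteq> 0" for P j
  proof -
    have "casimir *v (level_proj P j *v v) = c *\<^sub>R (level_proj P j *v v)"
      by (rule commuting_eigenspace[OF commute_level_proj[OF involution[OF that(1)]
            casimir_commute[OF that(1), symmetric], symmetric] cas])
    moreover have "sum_op P *v (level_proj P j *v v) = L j *\<^sub>R (level_proj P j *v v)"
      by (simp add: matrix_vector_mul_assoc sum_op_level_proj[OF involution[OF that(1)]]
          cmat_scale_vector scaleR_eq_vector_smult L_def)
    ultimately show ?thesis using that by (auto simp: W_def)
  qed
  have abs_le: "\<bar>l\<bar> \<le> m" if l: "l \<in> W" for l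
  proof -
    obtain P and u :: "complex^('i^'t)" where "P \<in> Z" "u \<noteq> 0" "casimir *v u = c *\<^sub>R u" "sum_op P *v u = l *\<^sub>R u"
      using l unfolding W_def by blast
    \<comment> \<open>Replacing \<open>P\<close> by \<open>- P\<close> makes the set of weights
      symmetric, so its maximum also bounds absolute values.\<close>
    then have "- l \<in> W"
      unfolding W_def by (intro CollectI bexI[of _ "- P"] exI[of _ u])
        (auto simp: uminus_closed sum_op_uminus matrix_vector_uminus)
    then show ?thesis using l fin by (auto simp: m_def abs_le_iff)
  qed
  obtain P0 where P0: "P0 \<in> Z" "sum_op P0 *v v \<noteq> 0" using moved by blast
  have "\<exists>j\<le>CARD('t). L j \<noteq> 0 \<and> level_proj P0 j *v v \<noteq> 0"
  proof (rule ccontr)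
    assume "\<not> ?thesis"
    then have "(norm (sum_op P0 *v v))\<^sup>2 = 0"
      unfolding level_proj_norm(3)[OF involution[OF P0(1)] hermitian[OF P0(1)]]
      by (intro sum.neutral) (auto simp: L_def)
    with P0 show False by simp
  qed
  then obtain j0 where "L j0 \<in> W" "L j0 \<noteq> 0" using level[OF P0(1)] by auto
  then have m_pos: "m > 0" using abs_le[of "L j0"] by auto
  have "m \<in> W" unfolding m_def using fin \<open>L j0 \<in> W\<close> by (intro Max_in) auto
  obtain J and w :: "complex^('i^'t)" where J: "J \<in> Z" and w: "w \<noteq> 0" "casimir *v w = c *\<^sub>R w" "sum_op J *v w = m *\<^sub>R w"
    using \<open>m \<in> W\<close> unfolding W_def by blast
  have m_le: "m \<le> real CARD('t)"
    using \<open>m \<in> W\<close> W_sub by (auto simp: L_def)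
  have c: "c \<ge> 2 * m\<^sup>2 + m * (real CARD('i) * (real CARD('i) - 2) / 2)"
  proof (rule casimir_lower_bound[OF J w(1) less_imp_le[OF m_pos] w(2,3)])
    fix u :: "complex^('i^'t)"
    assume "casimir *v u = c *\<^sub>R u" "sum_op J *v u = (m + 2) *\<^sub>R u"
    then have "u \<noteq> 0 \<Longrightarrow> m + 2 \<in> W" using J by (auto simp: W_def)
    then show "u = 0" using abs_le[of "m + 2"] by fastforce
  qed
  \<comment> \<open>On each level that \<open>v\<close> meets, the squared weight over
    \<open>m\<^sup>2\<close> is at most one, and it is zero on the level that
    \<open>zero_proj\<close> keeps.\<close>
  have defect: "(norm v)\<^sup>2 - inner v (zero_proj P *v v) \<ge> (norm (sum_op P *v v))\<^sup>2 / m\<^sup>2" if P: "P \<in> Z" for P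
    unfolding zero_proj_defect[OF involution[OF P] hermitian[OF P]]
      level_proj_norm(3)[OF involution[OF P] hermitian[OF P]] sum_divide_distrib
  proof (rule sum_mono)
    fix j
    show "(2 * real j - real CARD('t))\<^sup>2 * (norm (level_proj P j *v v))\<^sup>2 / m\<^sup>2
      \<le> (if 2 * j = CARD('t) then 0 else (norm (level_proj P j *v v))\<^sup>2)"
    proof (cases "2 * j = CARD('t) \<or> level_proj P j *v v = 0")
      case True
      then show ?thesis by (auto dest: arg_cong[where f = real])
    next
      case False
      then have "\<bar>L j\<bar> \<le> \<bar>m\<bar>" using abs_le[OF level[OF P]] m_pos by auto
      then have "(L j)\<^sup>2 \<le> m\<^sup>2" by (simp only: abs_le_square_iff)
      then show ?thesis
        using False m_pos by (simp add: L_def field_simps mult_right_mono)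
    qed
  qed
  \<comment> \<open>Here \<open>m_le\<close> brings in the number of tensor factors.\<close>
  have "(2 + real CARD('i) * (real CARD('i) - 2) / (2 * real CARD('t))) * (norm v)\<^sup>2
      \<le> (2 + real CARD('i) * (real CARD('i) - 2) / (2 * m)) * (norm v)\<^sup>2"
    using m_le m_pos N by (intro mult_right_mono add_left_mono divide_left_mono) auto
  also have "\<dots> = (2 * m\<^sup>2 + m * (real CARD('i) * (real CARD('i) - 2) / 2)) / m\<^sup>2 * (norm v)\<^sup>2"
    using m_pos by (simp add: field_simps power2_eq_square)
  also have "\<dots> \<le> c / m\<^sup>2 * (norm v)\<^sup>2"
    using c m_pos by (intro mult_right_mono divide_right_mono) auto
  also have "\<dots> = inner v (casimir *v v) / m\<^sup>2"
    by (simp add: cas power2_norm_eq_inner)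
  also have "\<dots> = (\<Sum>P\<in>Z. (norm (sum_op P *v v))\<^sup>2 / m\<^sup>2)"
    by (simp add: inner_casimir sum_divide_distrib)
  also have "\<dots> \<le> (\<Sum>P\<in>Z. (norm v)\<^sup>2 - inner v (zero_proj P *v v))"
    by (intro sum_mono defect)
  finally show ?thesis .
qed

end

section \<open>Invariance under the special orthogonal group\<close>

definition complexify :: "real^'m::finite^'n::finite \<Rightarrow> complex^'m^'n" where
  "complexify R = (\<chi> i j. complex_of_real (R $ i $ j))"

lemma complexify_nth [simp]: "complexify R $ i $ j = of_real (R $ i $ j)"
  by (simp add: complexify_def)

lemma complexify_mult: "complexify (A ** B) = complexify A ** complexify B"
  by (simp add: vec_eq_iff matrix_mult_nth)

lemma complexify_one [simp]: "complexify (mat 1) = mat 1"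
  by (simp add: vec_eq_iff mat_nth)

lemma tensor_pow_mult: "tensor_pow U ** tensor_pow V = tensor_pow (U ** V)"
  by (simp add: tensor_pow_conv_family tensor_family_mult)

lemma tensor_pow_one: "tensor_pow (mat 1 :: 'a::comm_ring_1^'i::finite^'i) = (mat 1 :: 'a^('i^'t::finite)^('i^'t))"
  by (simp add: tensor_pow_conv_family tensor_family_one)

text \<open>Leibniz rule over the sites. If \<open>sum_op W\<close> kills \<open>v\<close>, the
  image of \<open>v\<close> is stationary along the curve.\<close>

lemma has_field_derivative_tensor_pow:
  fixes U :: "complex \<Rightarrow> complex^'i::finite^'i" and v :: "complex^('i^'t::finite)"
  assumes "\<And>i j. ((\<lambda>s. U s $ i $ j) has_field_derivative (U s ** W) $ i $ j) (at s)"
  shows "((\<lambda>s. (tensor_pow (U s) *v v) $ x) has_field_derivative (tensor_pow (U s) *v (sum_op W *v v)) $ x) (at s)"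
proof -
  have "((\<lambda>s. tensor_pow (U s) $ x $ y) has_field_derivative (tensor_pow (U s) ** sum_op W) $ x $ y) (at s)"
    for x y :: "'i^'t"
  proof -
    have "((\<lambda>s. \<Prod>k\<in>UNIV. U s $ (x $ k) $ (y $ k)) has_field_derivative
      (\<Sum>k\<in>UNIV. (U s ** W) $ (x $ k) $ (y $ k) * (\<Prod>l\<in>UNIV - {k}. U s $ (x $ l) $ (y $ l)))) (at s)"
      by (rule has_field_derivative_prod) (rule assms)
    moreover have "(tensor_pow (U s) ** sum_op W) $ x $ y =
      (\<Sum>k\<in>UNIV. (U s ** W) $ (x $ k) $ (y $ k) * (\<Prod>l\<in>UNIV - {k}. U s $ (x $ l) $ (y $ l)))"
      unfolding sum_op_def matrix_mult_sum_right tensor_pow_conv_family tensor_family_site_op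
      by (simp add: sum_component tensor_family_upd_nth)
    ultimately show ?thesis by (simp add: tensor_pow_def)
  qed
  then have "((\<lambda>s. \<Sum>y\<in>UNIV. tensor_pow (U s) $ x $ y * v $ y) has_field_derivative
      (\<Sum>y\<in>UNIV. (tensor_pow (U s) ** sum_op W) $ x $ y * v $ y)) (at s)"
    by (intro DERIV_sum DERIV_cmult_right)
  then show ?thesis
    by (simp add: matrix_vector_mult_nth matrix_vector_mul_assoc)
qed

text \<open>The Householder matrix, written with the bilinear form and no conjugation: it is thus
  polynomial in \<open>z\<close> and can be differentiated along curves with a complex
  parameter.\<close>

definition reflection :: "'a::comm_ring_1^'n::finite \<Rightarrow> 'a^'n^'n" where
  "reflection z = (\<chi> i j. (if i = j then 1 else 0) - 2 * z $ i * z $ j)"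

lemma reflection_nth: "reflection z $ i $ j = (if i = j then 1 else 0) - 2 * z $ i * z $ j"
  by (simp add: reflection_def)

lemma reflection_mult_nth:
  "(reflection z ** W) $ i $ j = W $ i $ j - 2 * z $ i * (\<Sum>k\<in>UNIV. z $ k * W $ k $ j)"
proof -
  have "(reflection z ** W) $ i $ j =
      (\<Sum>k\<in>UNIV. (if i = k then W $ k $ j else 0) - 2 * z $ i * (z $ k * W $ k $ j))"
    unfolding matrix_mult_nth by (intro sum.cong refl) (auto simp: reflection_nth algebra_simps)
  then show ?thesis by (simp add: sum_subtractf sum_distrib_left)
qed

lemma reflection_vector_mult:
  fixes a :: "real^'n::finite"
  shows "reflection a *v x = x - (2 * inner a x) *\<^sub>R a"
proof -
  have "(reflection a *v x) $ i = (\<Sum>k\<in>UNIV. (if i = k then x $ k else 0) - 2 * a $ i * (a $ k * x $ k))" for i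
    unfolding matrix_vector_mult_nth by (intro sum.cong refl) (auto simp: reflection_nth algebra_simps)
  then show ?thesis
    by (simp add: vec_eq_iff sum_subtractf inner_vec_def flip: sum_distrib_left)
qed

lemma reflection_square:
  fixes a :: "real^'n::finite"
  assumes "norm a = 1"
  shows "reflection a ** reflection a = mat 1"
proof -
  have "reflection a *v (reflection a *v x) = x" for x
    using assms by (simp add: reflection_vector_mult inner_diff_right norm_eq_1)
  then show ?thesis
    by (simp add: matrix_eq matrix_vector_mul_assoc)
qed

lemma transpose_reflection: "transpose (reflection a) = reflection a"
  by (simp add: vec_eq_iff transpose_def reflection_nth mult_ac)

lemma orthogonal_reflection:
  fixes a :: "real^'n::finite"
  assumes "norm a = 1"
  shows "orthogonal_matrix (reflection a)"
  by (simp add: orthogonal_matrix transpose_reflection reflection_square assms)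

lemma orthogonal_matrix_inner:
  fixes A :: "real^'n::finite^'n"
  assumes "orthogonal_matrix A"
  shows "inner (A *v x) (A *v y) = inner x y"
  using assms orthogonal_transformation_matrix[of "(*v) A"]
  by (simp add: orthogonal_transformation_def)

text \<open>An orthogonal matrix taking a coordinate axis to \<open>a\<close> conjugates the
  reflection into a diagonal one.\<close>

lemma det_reflection:
  fixes a :: "real^'n::finite"
  assumes "norm a = 1"
  shows "det (reflection a) = - 1"
proof -
  obtain k :: 'n where True by simp
  obtain A where A: "orthogonal_matrix A" "A *v axis k 1 = a"
    using orthogonal_matrix_exists_basis[OF assms] by blast
  let ?D = "reflection (axis k 1 :: real^'n)"
  have "reflection a ** A = A ** ?D"
  proof -
    have "inner a (A *v x) = inner (axis k 1) x" for x
      using orthogonal_matrix_inner[OF A(1), of "axis k 1" x] A(2) by simp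
    then have "(reflection a ** A) *v x = (A ** ?D) *v x" for x
      by (simp add: reflection_vector_mult matrix_vector_mult_diff_distrib matrix_vector_mult_scaleR A(2)
          flip: matrix_vector_mul_assoc)
    then show ?thesis by (simp add: matrix_eq)
  qed
  then have "det (reflection a) * det A = det A * det ?D"
    by (metis det_mul)
  moreover have "det A \<noteq> 0" using det_orthogonal_matrix[OF A(1)] by auto
  moreover have "det ?D = - 1"
  proof -
    have "det ?D = (\<Prod>i\<in>UNIV. ?D $ i $ i)"
      by (rule det_diagonal) (auto simp: reflection_nth axis_def)
    also have "\<dots> = (\<Prod>i\<in>UNIV. if i = k then - 1 else 1)"
      by (intro prod.cong) (auto simp: reflection_nth axis_def)
    finally show ?thesis by simp
  qed
  ultimately show ?thesis using mult_right_cancel[of "det A" "det (reflection a)" "- 1"] by simp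
qed

section \<open>From the Lie algebra to the group\<close>

context antisymmetric_frame
begin

text \<open>Contracting \<open>completeness\<close> with \<open>X\<close> gives N times the
  difference of \<open>X\<close> and its transpose. In particular the frame spans the antisymmetric
  matrices.\<close>

lemma antisymmetric_expansion:
  assumes X: "\<And>i j. X $ j $ i = - X $ i $ j"
  shows "(\<Sum>P\<in>Z. cmat_scale (\<Sum>k\<in>UNIV. \<Sum>l\<in>UNIV. P $ k $ l * X $ l $ k) P) =
    cmat_scale (2 * of_nat CARD('i)) X"
proof -
  have "(\<Sum>P\<in>Z. (\<Sum>k\<in>UNIV. \<Sum>l\<in>UNIV. P $ k $ l * X $ l $ k) * P $ i $ j) =
      2 * of_nat CARD('i) * X $ i $ j" for i j
  proof -
    have "(\<Sum>P\<in>Z. (\<Sum>k\<in>UNIV. \<Sum>l\<in>UNIV. P $ k $ l * X $ l $ k) * P $ i $ j) =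
        (\<Sum>P\<in>Z. \<Sum>k\<in>UNIV. \<Sum>l\<in>UNIV. X $ l $ k * (P $ i $ j * P $ k $ l))"
      unfolding sum_distrib_right by (intro sum.cong refl) (simp add: mult_ac)
    also have "\<dots> = (\<Sum>k\<in>UNIV. \<Sum>P\<in>Z. \<Sum>l\<in>UNIV. X $ l $ k * (P $ i $ j * P $ k $ l))"
      by (rule sum.swap)
    also have "\<dots> = (\<Sum>k\<in>UNIV. \<Sum>l\<in>UNIV. X $ l $ k * (\<Sum>P\<in>Z. P $ i $ j * P $ k $ l))"
      unfolding sum_distrib_left by (intro sum.cong refl) (rule sum.swap)
    also have "\<dots> = (\<Sum>k\<in>UNIV. \<Sum>l\<in>UNIV.
        (if j = k then (if i = l then of_nat CARD('i) * X $ l $ k else 0) else 0) -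
        (if i = k then (if j = l then of_nat CARD('i) * X $ l $ k else 0) else 0))"
      unfolding completeness by (intro sum.cong refl) (simp add: mult_ac)
    also have "\<dots> = of_nat CARD('i) * X $ i $ j - of_nat CARD('i) * X $ j $ i"
    proof -
      have "(\<Sum>l\<in>UNIV. if a = b then (if c = l then f l else 0) else 0) = (if a = b then f c else (0::complex))"
        for a b c :: 'i and f by simp
      then show ?thesis by (simp add: sum_subtractf)
    qed
    finally show ?thesis using X[of j i] by simp
  qed
  then show ?thesis by (simp add: vec_eq_iff sum_component)
qed

lemma killed_by_antisymmetric:
  fixes v :: "complex^('i^'t::finite)"
  assumes v: "\<And>P. P \<in> Z \<Longrightarrow> sum_op P *v v = 0" and X: "\<And>i j. X $ j $ i = - X $ i $ j"
  shows "sum_op X *v v = 0"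
proof -
  have "(2 * of_nat CARD('i)) *s (sum_op X *v v) = sum_op (cmat_scale (2 * of_nat CARD('i)) X) *v v"
    by (simp add: sum_op_scale cmat_scale_vector)
  also have "\<dots> = 0"
    by (simp flip: antisymmetric_expansion[OF X])
      (simp add: sum_op_sum sum_op_scale matrix_vector_mult_sum_left cmat_scale_vector v)
  finally show ?thesis by (simp add: vec_eq_iff)
qed

text \<open>Along \<open>z = cos s a + sin s b\<close> the reflections satisfy \<open>R' = R ** W\<close> with
  \<open>W = 2 (z y^T - y z^T)\<close> antisymmetric, \<open>y = z'\<close>.\<close>

lemma reflection_circle:
  fixes v :: "complex^('i^'t::finite)" and a b :: "complex^'i"
  assumes v: "\<And>P. P \<in> Z \<Longrightarrow> sum_op P *v v = 0"
    and aa: "(\<Sum>k\<in>UNIV. a $ k * a $ k) = 1" and bb: "(\<Sum>k\<in>UNIV. b $ k * b $ k) = 1"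
    and ab: "(\<Sum>k\<in>UNIV. a $ k * b $ k) = 0"
  shows "tensor_pow (reflection (cos s *s a + sin s *s b)) *v v = tensor_pow (reflection a) *v v"
proof -
  define z where "z s = cos s *s a + sin s *s b" for s
  define y where "y s = cos s *s b - sin s *s a" for s
  have zz: "(\<Sum>k\<in>UNIV. z s $ k * z s $ k) = 1" for s
  proof -
    have "(\<Sum>k\<in>UNIV. z s $ k * z s $ k) = (\<Sum>k\<in>UNIV. (cos s)\<^sup>2 * (a $ k * a $ k) +
        2 * sin s * cos s * (a $ k * b $ k) + (sin s)\<^sup>2 * (b $ k * b $ k))"
      by (intro sum.cong refl) (simp add: z_def power2_eq_square algebra_simps)
    then show ?thesis by (simp add: sum.distrib aa bb ab flip: sum_distrib_left)
  qed
  have zy: "(\<Sum>k\<in>UNIV. z s $ k * y s $ k) = 0" for s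
  proof -
    have "(\<Sum>k\<in>UNIV. z s $ k * y s $ k) = (\<Sum>k\<in>UNIV. sin s * cos s * (b $ k * b $ k) +
        ((cos s)\<^sup>2 - (sin s)\<^sup>2) * (a $ k * b $ k) - sin s * cos s * (a $ k * a $ k))"
      by (intro sum.cong refl) (simp add: z_def y_def power2_eq_square algebra_simps)
    then show ?thesis by (simp add: sum.distrib sum_subtractf aa bb ab flip: sum_distrib_left)
  qed
  define W where "W s = (\<chi> i j. 2 * (z s $ i * y s $ j - y s $ i * z s $ j))" for s
  have zW: "(\<Sum>k\<in>UNIV. z s $ k * W s $ k $ j) = 2 * y s $ j" for s j
  proof -
    have "(\<Sum>k\<in>UNIV. z s $ k * W s $ k $ j) =
        (\<Sum>k\<in>UNIV. 2 * y s $ j * (z s $ k * z s $ k) - 2 * z s $ j * (z s $ k * y s $ k))"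
      by (intro sum.cong refl) (simp add: W_def algebra_simps)
    then show ?thesis by (simp add: sum_subtractf zz zy flip: sum_distrib_left)
  qed
  \<comment> \<open>The right-hand side is the derivative of \<open>- 2 * z $ i * z $ j\<close>, as
    \<open>y\<close> is the derivative of \<open>z\<close>.\<close>
  have RW: "(reflection (z s) ** W s) $ i $ j = - 2 * (y s $ i * z s $ j + z s $ i * y s $ j)" for s i j
    unfolding reflection_mult_nth zW by (simp add: W_def algebra_simps)
  have "((\<lambda>s. reflection (z s) $ i $ j) has_field_derivative (reflection (z s) ** W s) $ i $ j) (at s)" for s i j
    unfolding RW reflection_nth
    by (auto intro!: derivative_eq_intros simp: z_def y_def algebra_simps)
  then have "((\<lambda>s. (tensor_pow (reflection (z s)) *v v) $ x) has_field_derivative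
      (tensor_pow (reflection (z s)) *v (sum_op (W s) *v v)) $ x) (at s)" for x s
    by (rule has_field_derivative_tensor_pow)
  moreover have "sum_op (W s) *v v = 0" for s
    by (rule killed_by_antisymmetric[OF v]) (simp_all add: W_def)
  ultimately have "((\<lambda>s. (tensor_pow (reflection (z s)) *v v) $ x) has_field_derivative 0) (at s)" for x s
    by simp
  then have "\<exists>c. \<forall>s\<in>UNIV. (tensor_pow (reflection (z s)) *v v) $ x = c" for x
    by (intro has_field_derivative_zero_constant) (auto intro: has_field_derivative_at_within)
  then have "(tensor_pow (reflection (z s)) *v v) $ x = (tensor_pow (reflection (z 0)) *v v) $ x" for x
    by (metis UNIV_I)
  then show ?thesis by (simp add: vec_eq_iff z_def)
qed

text \<open>If \<open>b\<close> is \<open>a\<close> or \<open>- a\<close>, the two reflections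
  coincide. Otherwise Gram-Schmidt yields a unit vector \<open>e\<close> orthogonal to
  \<open>a\<close> such that \<open>b\<close> lies on the circle through \<open>a\<close> and
  \<open>e\<close>.\<close>

lemma reflections_act_equally:
  fixes v :: "complex^('i^'t::finite)" and a b :: "real^'i"
  assumes v: "\<And>P. P \<in> Z \<Longrightarrow> sum_op P *v v = 0" and a: "norm a = 1" and b: "norm b = 1"
  shows "tensor_pow (complexify (reflection a)) *v v = tensor_pow (complexify (reflection b)) *v v"
proof -
  define cv where "cv x = (\<chi> k. complex_of_real (x $ k))" for x :: "real^'i"
  have cx: "complexify (reflection x) = reflection (cv x)" for x
    by (simp add: vec_eq_iff reflection_nth cv_def)
  have ci: "(\<Sum>k\<in>UNIV. cv x $ k * cv y $ k) = of_real (inner x y)" for x y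
    by (simp add: cv_def inner_vec_def)
  define u where "u = b - inner a b *\<^sub>R a"
  have au: "inner a u = 0" using a by (simp add: u_def inner_diff_right norm_eq_1)
  show ?thesis
  proof (cases "u = 0")
    case True
    then have eq: "b = inner a b *\<^sub>R a" by (simp add: u_def)
    then have "\<bar>inner a b\<bar> = 1" using a b by (metis mult.right_neutral norm_scaleR)
    then have "inner a b * inner a b = 1" by (metis abs_mult_self_eq mult_1)
    moreover have "b $ i * b $ j = (inner a b * inner a b) * (a $ i * a $ j)" for i j
      by (subst (1 2) eq) simp
    ultimately have "b $ i * b $ j = a $ i * a $ j" for i j by simp
    then have "reflection a = reflection b" by (simp add: vec_eq_iff reflection_nth mult.assoc)
    then show ?thesis by simp
  next
    case False
    define e where "e = u /\<^sub>R norm u"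
    have e: "norm e = 1" "inner a e = 0" using False au by (simp_all add: e_def)
    have be: "b = inner a b *\<^sub>R a + norm u *\<^sub>R e" using False by (simp add: e_def u_def)
    have "inner b b = (inner a b)\<^sup>2 + (norm u)\<^sup>2"
      by (subst (1 2) be) (use a e in \<open>simp add: inner_simps inner_commute[of e a] norm_eq_1 power2_eq_square\<close>)
    then have "(inner a b)\<^sup>2 + (norm u)\<^sup>2 = 1" using b by (simp add: norm_eq_1)
    then obtain s where s: "inner a b = cos s" "norm u = sin s"
      by (metis sincos_total_2pi)
    have "cv b = cos (of_real s) *s cv a + sin (of_real s) *s cv e"
      unfolding cos_of_real sin_of_real s[symmetric] by (subst be) (simp add: cv_def vec_eq_iff)
    then show ?thesis
      unfolding cx using a e
      by (simp add: reflection_circle[OF v] ci norm_eq_1)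
  qed
qed

text \<open>Every reflection exchanges \<open>v\<close> with one and the same vector \<open>v'\<close>, so the image of \<open>v\<close>
  under a product of reflections only depends on the determinant of the product.\<close>

lemma SO_invariant:
  fixes v :: "complex^('i^'t::finite)" and U :: "real^'i^'i"
  assumes v: "\<And>P. P \<in> Z \<Longrightarrow> sum_op P *v v = 0" and U: "U \<in> SO"
  shows "tensor_pow (complexify U) *v v = v"
proof -
  obtain a0 :: "real^'i" where a0: "norm a0 = 1" using vector_choose_size[of 1] by auto
  define v' where "v' = tensor_pow (complexify (reflection a0)) *v v"
  have R1: "tensor_pow (complexify (reflection a)) *v v = v'" if "norm a = 1" for a
    unfolding v'_def by (rule reflections_act_equally[OF v that a0])
  have R2: "tensor_pow (complexify (reflection a)) *v v' = v" if "norm a = 1" for a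
    using that
    by (simp flip: R1[OF that] complexify_mult
      add: matrix_vector_mul_assoc tensor_pow_mult reflection_square tensor_pow_one)
  define Fix where "Fix U = {x. U *v x = x}" for U :: "real^'i^'i"
  have sub: "subspace (Fix U)" for U
    by (auto simp: Fix_def subspace_def matrix_vector_right_distrib matrix_vector_mult_scaleR)
  \<comment> \<open>Both determinants are carried along because splitting off a reflection changes
    the sign. The induction, on the codimension of the fixed space, is that of Cartan and
    Dieudonne.\<close>
  have "orthogonal_matrix U \<Longrightarrow>
      (det U = 1 \<longrightarrow> tensor_pow (complexify U) *v v = v) \<and> (det U = - 1 \<longrightarrow> tensor_pow (complexify U) *v v = v')"
    for U :: "real^'i^'i"
  proof (induction "CARD('i) - dim (Fix U)" arbitrary: U rule: less_induct)
    case less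
    show ?case
    proof (cases "U = mat 1")
      case True
      then show ?thesis by (simp add: tensor_pow_one)
    next
      case False
      then obtain x where x: "U *v x \<noteq> x" by (auto simp: matrix_eq)
      \<comment> \<open>Reflecting along \<open>d\<close> sends \<open>U *v x\<close> back to
        \<open>x\<close>. As \<open>d\<close> is orthogonal to \<open>Fix U\<close>, nothing fixed
        is lost, so the fixed space grows strictly.\<close>
      define d where "d = U *v x - x"
      define a where "a = d /\<^sub>R norm d"
      have d0: "d \<noteq> 0" using x by (simp add: d_def)
      then have a: "norm a = 1" by (simp add: a_def)
      define U' where "U' = reflection a ** U"
      have UU': "U = reflection a ** U'"
        by (simp add: U'_def matrix_mul_assoc reflection_square[OF a])
      have orth': "orthogonal_matrix U'"
        unfolding U'_def using orthogonal_reflection[OF a] less.prems by (rule orthogonal_matrix_mul)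
      have refl: "reflection a *v y = y - (2 * inner d y / (norm d)\<^sup>2) *\<^sub>R d" for y
        by (simp add: reflection_vector_mult a_def power2_eq_square divide_inverse mult_ac)
      have "inner d (U *v x) = (norm d)\<^sup>2 / 2"
      proof -
        have "inner (U *v x) (U *v x) = inner x x"
          using orthogonal_matrix_inner[OF less.prems] .
        then show ?thesis
          by (simp add: d_def power2_norm_eq_inner inner_simps inner_commute)
      qed
      then have "2 * inner d (U *v x) / (norm d)\<^sup>2 = 1" using d0 by simp
      then have "reflection a *v (U *v x) = U *v x - d" by (simp only: refl scaleR_one)
      then have fix_x: "x \<in> Fix U'"
        by (simp add: Fix_def U'_def d_def flip: matrix_vector_mul_assoc)
      have "y \<in> Fix U'" if "y \<in> Fix U" for y
      proof -
        have y: "U *v y = y" using that by (simp add: Fix_def)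
        have "inner d y = 0"
          using orthogonal_matrix_inner[OF less.prems, of x y] by (simp add: y d_def inner_diff_left)
        then show ?thesis
          by (simp add: Fix_def U'_def refl y flip: matrix_vector_mul_assoc)
      qed
      then have "Fix U \<subset> Fix U'"
        using fix_x x by (auto simp: Fix_def)
      then have "dim (Fix U) < dim (Fix U')"
        by (intro dim_psubset) (simp add: span_eq_iff[THEN iffD2, OF sub])
      moreover have "dim (Fix U') \<le> CARD('i)"
        using dim_subset_UNIV[of "Fix U'"] by simp
      ultimately have IH: "(det U' = 1 \<longrightarrow> tensor_pow (complexify U') *v v = v) \<and>
          (det U' = - 1 \<longrightarrow> tensor_pow (complexify U') *v v = v')"
        by (intro less.hyps orth') linarith
      have "det U = - det U'" by (subst UU') (simp add: det_mul det_reflection[OF a])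
      moreover have "tensor_pow (complexify U) *v v =
          tensor_pow (complexify (reflection a)) *v (tensor_pow (complexify U') *v v)"
        by (subst UU') (simp add: complexify_mult matrix_vector_mul_assoc flip: tensor_pow_mult)
      ultimately show ?thesis using IH R1[OF a] R2[OF a] by auto
    qed
  qed
  then show ?thesis using U by (simp add: SO_def)
qed

end

section \<open>Haar averages\<close>

lemma tensor_pow_complexify: "tensor_pow (complexify R) = complexify (tensor_pow R)"
  by (simp add: vec_eq_iff tensor_pow_def)

lemma transpose_tensor_pow: "transpose (tensor_pow R) = tensor_pow (transpose R)"
  by (simp add: vec_eq_iff tensor_pow_def transpose_def)

lemma SO_transpose: "U \<in> SO \<Longrightarrow> transpose U \<in> SO"
  by (simp add: SO_def)

lemma orthogonal_matrix_entry_le_1: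
  fixes R :: "real^'n::finite^'n"
  assumes "orthogonal_matrix R"
  shows "\<bar>R $ i $ j\<bar> \<le> 1"
proof -
  have "norm (row i R) = 1" using assms by (simp add: orthogonal_matrix_orthonormal_rows)
  then show ?thesis using component_le_norm_cart[of "row i R" j] by (simp add: row_def)
qed

lemma tensor_pow_SO_bound: "R \<in> SO \<Longrightarrow> \<bar>(tensor_pow R) $ x $ y\<bar> \<le> (1::real)"
  unfolding tensor_pow_def
  by (simp add: abs_prod) (rule prod_le_1, simp add: SO_def orthogonal_matrix_entry_le_1)

lemma continuous_on_tensor_pow_entry:
  "continuous_on UNIV (\<lambda>R :: real^'i::finite^'i. (tensor_pow R :: real^('i^'t::finite)^('i^'t)) $ x $ y)"
  unfolding tensor_pow_def by (simp, intro continuous_intros)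

lemma continuous_on_matrix_mult_left:
  fixes U :: "real^'n::finite^'n"
  shows "continuous_on UNIV (\<lambda>R :: real^'n^'n. U ** R)"
  unfolding matrix_matrix_mult_def by (intro continuous_intros)

locale haar_SO =
  fixes \<mu> :: "(real^'i::finite^'i) measure"
  assumes haar: "is_haar_SO \<mu>"
begin

sublocale prob_space \<mu>
  using haar by (simp add: is_haar_SO_def)

lemma sets_haar: "sets \<mu> = sets borel"
  using haar by (simp add: is_haar_SO_def)

text \<open>The measure lives on all real matrices, so identities valid on \<open>SO\<close> enter
  the integrals almost everywhere only.\<close>

lemma AE_SO: "AE R in \<mu>. R \<in> SO"
  using haar by (intro AE_prob_1) (simp add: is_haar_SO_def measure_def)

lemma borel_measurable_haar: "f \<in> borel_measurable borel \<Longrightarrow> f \<in> borel_measurable \<mu>"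
  using measurable_cong_sets[OF sets_haar refl] by blast

definition mean_tensor :: "real^('i^'t::finite)^('i^'t)" where
  "mean_tensor = (\<chi> x y. \<integral>R. tensor_pow R $ x $ y \<partial>\<mu>)"

lemma haar_avg_eq: "haar_avg \<mu> = complexify mean_tensor"
  by (simp add: haar_avg_def mean_tensor_def vec_eq_iff)

lemma integrable_tensor_pow:
  "integrable \<mu> (\<lambda>R. (tensor_pow R :: real^('i^'t::finite)^('i^'t)) $ x $ y)"
proof (rule integrable_const_bound[where B = 1])
  show "AE R in \<mu>. norm ((tensor_pow R :: real^('i^'t)^('i^'t)) $ x $ y) \<le> 1"
    using AE_SO by eventually_elim (simp add: tensor_pow_SO_bound)
qed (intro borel_measurable_haar borel_measurable_continuous_onI continuous_on_tensor_pow_entry)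

lemma mean_tensor_left_invariant:
  assumes U: "U \<in> SO"
  shows "tensor_pow U ** mean_tensor = (mean_tensor :: real^('i^'t::finite)^('i^'t))"
proof -
  have "(\<integral>R. tensor_pow (U ** R) $ x $ y \<partial>\<mu>) = mean_tensor $ x $ y" for x y :: "'i^'t"
  proof -
    have meas: "(\<lambda>R. U ** R) \<in> measurable \<mu> \<mu>"
      unfolding measurable_cong_sets[OF sets_haar sets_haar]
      by (intro borel_measurable_continuous_onI continuous_on_matrix_mult_left)
    have "mean_tensor $ x $ y = (\<integral>R. tensor_pow R $ x $ y \<partial>distr \<mu> \<mu> (\<lambda>R. U ** R))"
      using haar U by (simp add: is_haar_SO_def mean_tensor_def)
    also have "\<dots> = (\<integral>R. tensor_pow (U ** R) $ x $ y \<partial>\<mu>)"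
      by (rule integral_distr[OF meas])
        (intro borel_measurable_haar borel_measurable_continuous_onI continuous_on_tensor_pow_entry)
    finally show ?thesis by simp
  qed
  moreover have "(tensor_pow U ** mean_tensor) $ x $ y = (\<integral>R. tensor_pow (U ** R) $ x $ y \<partial>\<mu>)" for x y :: "'i^'t"
  proof -
    have "(tensor_pow U ** mean_tensor) $ x $ y =
        (\<integral>R. (\<Sum>z\<in>UNIV. tensor_pow U $ x $ z * tensor_pow R $ z $ y) \<partial>\<mu>)"
      by (simp add: matrix_mult_nth mean_tensor_def integrable_tensor_pow)
    then show ?thesis by (simp flip: matrix_mult_nth add: tensor_pow_mult)
  qed
  ultimately show ?thesis by (simp add: vec_eq_iff)
qed

text \<open>Left invariance under the transposes of rotations gives
  \<open>transpose G ** G = G\<close>, and the left side is symmetric. Invariance of the measure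
  under inversion is thereby avoided.\<close>

lemma transpose_mean_tensor: "transpose mean_tensor = (mean_tensor :: real^('i^'t::finite)^('i^'t))"
proof -
  let ?G = "mean_tensor :: real^('i^'t)^('i^'t)"
  have "(transpose ?G ** ?G) $ x $ y = ?G $ x $ y" for x y
  proof -
    have "(transpose ?G ** ?G) $ x $ y = (\<integral>R. (\<Sum>z\<in>UNIV. tensor_pow R $ z $ x * ?G $ z $ y) \<partial>\<mu>)"
      by (simp add: matrix_mult_nth transpose_def integrable_tensor_pow) (simp add: mean_tensor_def)
    also have "\<dots> = (\<integral>R. ?G $ x $ y \<partial>\<mu>)"
    proof (rule integral_cong_AE)
      show "AE R in \<mu>. (\<Sum>z\<in>UNIV. tensor_pow R $ z $ x * ?G $ z $ y) = ?G $ x $ y"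
        using AE_SO
      proof eventually_elim
        case (elim R)
        have "(\<Sum>z\<in>UNIV. tensor_pow R $ z $ x * ?G $ z $ y) = (tensor_pow (transpose R) ** ?G) $ x $ y"
          unfolding transpose_tensor_pow[symmetric] by (simp add: matrix_mult_nth transpose_def)
        then show ?case
          by (simp add: mean_tensor_left_invariant SO_transpose elim)
      qed
    qed (auto intro!: borel_measurable_sum borel_measurable_times borel_measurable_integrable integrable_tensor_pow)
    also have "\<dots> = ?G $ x $ y" by (simp add: prob_space)
    finally show ?thesis .
  qed
  then have "transpose ?G ** ?G = ?G" by (simp add: vec_eq_iff)
  then show ?thesis by (metis matrix_transpose_mul transpose_transpose)
qed

lemma mat_adj_haar_avg: "mat_adj (haar_avg \<mu>) = (haar_avg \<mu> :: complex^('i^'t::finite)^('i^'t))"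
proof -
  have "mean_tensor $ y $ x = mean_tensor $ x $ y" for x y :: "'i^'t"
    using arg_cong[OF transpose_mean_tensor, of "\<lambda>A. A $ x $ y"] by (simp add: transpose_def)
  then show ?thesis by (simp add: haar_avg_eq vec_eq_iff)
qed

lemma haar_avg_left_invariant:
  assumes "U \<in> SO"
  shows "tensor_pow (complexify U) ** haar_avg \<mu> = (haar_avg \<mu> :: complex^('i^'t::finite)^('i^'t))"
  by (simp add: haar_avg_eq tensor_pow_complexify mean_tensor_left_invariant[OF assms] flip: complexify_mult)

lemma haar_avg_fixes_invariant:
  fixes v :: "complex^('i^'t::finite)"
  assumes v: "\<And>U. U \<in> SO \<Longrightarrow> tensor_pow (complexify U) *v v = v"
  shows "haar_avg \<mu> *v v = v"
proof -
  have "(haar_avg \<mu> *v v) $ x = v $ x" for x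
  proof -
    have int: "integrable \<mu> (\<lambda>R. complex_of_real (tensor_pow R $ x $ y) * v $ y)" for y
      by (intro integrable_mult_left integrable_of_real integrable_tensor_pow)
    have "(haar_avg \<mu> *v v) $ x = (\<Sum>y\<in>UNIV. \<integral>R. complex_of_real (tensor_pow R $ x $ y) * v $ y \<partial>\<mu>)"
      by (simp add: matrix_vector_mult_nth haar_avg_def)
    also have "\<dots> = (\<integral>R. (\<Sum>y\<in>UNIV. complex_of_real (tensor_pow R $ x $ y) * v $ y) \<partial>\<mu>)"
      by (rule Bochner_Integration.integral_sum[symmetric]) (rule int)
    also have "\<dots> = (\<integral>R. v $ x \<partial>\<mu>)"
    proof (rule integral_cong_AE)
      show "AE R in \<mu>. (\<Sum>y\<in>UNIV. complex_of_real (tensor_pow R $ x $ y) * v $ y) = v $ x"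
        using AE_SO
      proof eventually_elim
        case (elim R)
        then show ?case
          using v[OF elim] by (simp add: tensor_pow_complexify vec_eq_iff matrix_vector_mult_nth)
      qed
    qed (use int in \<open>auto intro!: borel_measurable_sum borel_measurable_integrable\<close>)
    finally show ?thesis by (simp add: prob_space)
  qed
  then show ?thesis by (simp add: vec_eq_iff)
qed

end

section \<open>Exponentials of antisymmetric involutions\<close>

lemma mat_pow_involution:
  assumes "P ** P = mat 1"
  shows "mat_pow (cmat_scale c P) k =
    cmat_scale (c ^ k) (half_proj P) + cmat_scale ((- c) ^ k) (half_proj (- P))"
proof (induction k)
  case 0
  then show ?case by (simp add: mat_pow_def half_proj_add)
next
  case (Suc k)
  have "mat_pow (cmat_scale c P) (Suc k) = cmat_scale c P ** mat_pow (cmat_scale c P) k"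
    by (simp add: mat_pow_def)
  then show ?case
    by (simp add: Suc.IH matrix_add_ldistrib cmat_scale_mult_left cmat_scale_mult_right
        involution_half_proj[OF assms]) (simp add: vec_eq_iff algebra_simps)
qed

lemma mat_exp_involution:
  assumes "P ** P = mat 1"
  shows "mat_exp (cmat_scale c P) =
    cmat_scale (exp c) (half_proj P) + cmat_scale (exp (- c)) (half_proj (- P))"
proof -
  have "(\<lambda>k. mat_pow (cmat_scale c P) k $ i $ j / of_nat (fact k)) sums
      (exp c * half_proj P $ i $ j + exp (- c) * half_proj (- P) $ i $ j)" for i j
  proof -
    have "(\<lambda>k. (c ^ k /\<^sub>R fact k) * half_proj P $ i $ j + ((- c) ^ k /\<^sub>R fact k) * half_proj (- P) $ i $ j) sums
      (exp c * half_proj P $ i $ j + exp (- c) * half_proj (- P) $ i $ j)"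
      by (intro sums_add sums_mult2 exp_converges)
    then show ?thesis
      by (simp add: mat_pow_involution[OF assms] scaleR_conv_of_real[where 'a=complex] field_simps)
  qed
  then show ?thesis by (simp add: mat_exp_def vec_eq_iff sums_iff)
qed

text \<open>With the half angle, \<open>2 * pi\<close> is no period for odd \<open>l\<close>; the
  length \<open>4 * pi\<close> of the interval is one for every \<open>l\<close>.\<close>

lemma has_integral_exp_period:
  fixes l :: int
  shows "((\<lambda>\<theta>::real. exp (\<i> * of_real (\<theta> / 2) * of_int l)) has_integral (if l = 0 then 4 * pi else 0)) {- 2 * pi..2 * pi}"
proof (cases "l = 0")
  case True
  then show ?thesis
    using has_integral_const_real[of "1 :: complex" "- 2 * pi" "2 * pi"]
    by (simp add: scaleR_conv_of_real[where 'a=complex])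
next
  case False
  define F where "F \<theta> = exp (\<i> * of_real (\<theta> / 2) * of_int l) / (\<i> * of_int l / 2)" for \<theta> :: real
  have "(F has_vector_derivative exp (\<i> * of_real (\<theta> / 2) * of_int l)) (at \<theta> within S)" for \<theta> S
    unfolding F_def using False
    by (auto intro!: derivative_eq_intros has_vector_derivative_real_field simp: field_simps)
  then have "((\<lambda>\<theta>. exp (\<i> * of_real (\<theta> / 2) * of_int l)) has_integral (F (2 * pi) - F (- 2 * pi))) {- 2 * pi..2 * pi}"
    by (intro fundamental_theorem_of_calculus) auto
  moreover have "F (2 * pi) = F (- 2 * pi)"
  proof -
    have "exp (\<i> * of_real pi * of_int l) = exp (- (\<i> * of_real pi * of_int l)) * exp (2 * of_int l * of_real pi * \<i>)"
      by (subst exp_add[symmetric]) (simp add: algebra_simps)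
    also have "exp (2 * complex_of_int l * of_real pi * \<i>) = 1"
      using exp_integer_2pi[of "of_int l"] by (simp add: mult_ac)
    finally show ?thesis by (simp add: F_def)
  qed
  ultimately show ?thesis using False by simp
qed

lemma has_integral_tensor_pow_mat_exp:
  fixes P :: "complex^'i::finite^'i" and x y :: "'i^'t::finite"
  assumes P: "P ** P = mat 1"
  shows "((\<lambda>\<theta>::real. tensor_pow (mat_exp (cmat_scale (\<i> * of_real (\<theta> / 2)) P)) $ x $ y)
    has_integral (4 * pi * zero_proj P $ x $ y)) {- 2 * pi..2 * pi}"
proof -
  define l where "l K = 2 * int (card K) - int CARD('t)" for K :: "'t set"
  have eq: "tensor_pow (mat_exp (cmat_scale (\<i> * of_real (\<theta> / 2)) P)) $ x $ y =
      (\<Sum>K\<in>UNIV. exp (\<i> * of_real (\<theta> / 2) * of_int (l K)) * weight_proj P K $ x $ y)" for \<theta> :: real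
  proof -
    define c where "c = \<i> * of_real (\<theta> / 2)"
    have "exp c ^ card K * exp (- c) ^ (CARD('t) - card K) = exp (c * of_int (l K))" for K :: "'t set"
    proof -
      have "card K \<le> CARD('t)" by (rule card_mono) auto
      then show ?thesis
        by (simp add: l_def of_nat_diff algebra_simps flip: exp_of_nat_mult exp_add)
    qed
    then show ?thesis
      unfolding c_def[symmetric] mat_exp_involution[OF P] tensor_pow_conv_family tensor_family_half_proj
      by (simp add: sum_component)
  qed
  have "((\<lambda>\<theta>::real. \<Sum>K\<in>UNIV. exp (\<i> * of_real (\<theta> / 2) * of_int (l K)) * weight_proj P K $ x $ y)
      has_integral (\<Sum>K\<in>UNIV. (if l K = 0 then 4 * pi else 0) * weight_proj P K $ x $ y)) {- 2 * pi..2 * pi}"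
    by (intro has_integral_sum has_integral_mult_left has_integral_exp_period) simp
  also have "(\<Sum>K\<in>UNIV. (if l K = 0 then 4 * pi else 0) * weight_proj P K $ x $ y) =
      (\<Sum>K\<in>UNIV. if l K = 0 then 4 * pi * weight_proj P K $ x $ y else 0)"
    by (intro sum.cong) auto
  also have "\<dots> = 4 * pi * (\<Sum>K | l K = 0. weight_proj P K $ x $ y)"
    by (simp add: sum.If_cases sum_distrib_left)
  also have "(\<Sum>K | l K = 0. weight_proj P K $ x $ y) = zero_proj P $ x $ y"
  proof (cases "even CARD('t)")
    case True
    then have "{K. l K = 0} = {K. card K = CARD('t) div 2}" by (auto simp: l_def)
    then show ?thesis using True by (simp add: zero_proj_def level_proj_def sum_component)
  next
    case False
    have "l K \<noteq> 0" for K
    proof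
      assume "l K = 0"
      then have "int (2 * card K) = int CARD('t)" by (simp add: l_def)
      then have "2 * card K = CARD('t)" by (simp only: of_nat_eq_iff)
      then show False using False by (metis dvd_triv_left)
    qed
    then have "{K. l K = 0} = {}" by simp
    then show ?thesis using False by (simp add: zero_proj_def)
  qed
  finally show ?thesis unfolding eq by simp
qed

text \<open>Averaging the hypothesis over the angle replaces the exponentials by
  \<open>zero_proj P\<close>.\<close>

lemma zero_proj_invariant:
  fixes P :: "complex^'i::finite^'i" and G :: "complex^('i^'t::finite)^('i^'t)"
  assumes P: "P ** P = mat 1"
    and G: "\<And>\<theta>::real. tensor_pow (mat_exp (cmat_scale (\<i> * of_real (\<theta> / 2)) P)) ** G = G"
  shows "zero_proj P ** G = G"
proof -
  have "(zero_proj P ** G) $ x $ y = G $ x $ y" for x y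
  proof -
    have "((\<lambda>\<theta>::real. (tensor_pow (mat_exp (cmat_scale (\<i> * of_real (\<theta> / 2)) P)) ** G) $ x $ y)
        has_integral (\<Sum>z\<in>UNIV. 4 * pi * zero_proj P $ x $ z * G $ z $ y)) {- 2 * pi..2 * pi}"
      unfolding matrix_mult_nth
      by (intro has_integral_sum has_integral_mult_left has_integral_tensor_pow_mat_exp P) simp
    moreover have "((\<lambda>\<theta>::real. (tensor_pow (mat_exp (cmat_scale (\<i> * of_real (\<theta> / 2)) P)) ** G) $ x $ y)
        has_integral (4 * pi * G $ x $ y)) {- 2 * pi..2 * pi}"
      using has_integral_const_real[of "G $ x $ y" "- 2 * pi" "2 * pi"]
      unfolding G by (simp add: scaleR_conv_of_real[where 'a=complex])
    ultimately have "(\<Sum>z\<in>UNIV. 4 * pi * zero_proj P $ x $ z * G $ z $ y) = 4 * pi * G $ x $ y"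
      by (rule has_integral_unique)
    then show ?thesis
      by (simp add: matrix_mult_nth mult.assoc flip: sum_distrib_left)
  qed
  then show ?thesis by (simp add: vec_eq_iff)
qed

lemma complexify_inject: "complexify A = complexify B \<longleftrightarrow> A = B"
  by (simp add: vec_eq_iff)

lemma complexify_transpose: "complexify (transpose A) = transpose (complexify A)"
  by (simp add: vec_eq_iff transpose_def)

text \<open>A Hermitian antisymmetric \<open>P\<close> has imaginary entries, so conjugation
  exchanges the two half projections and the exponential is real.\<close>

lemma mat_exp_antisymmetric_SO:
  fixes P :: "complex^'i::finite^'i" and s :: real
  assumes P: "P ** P = mat 1" and herm: "mat_adj P = P" and anti: "\<And>i j. P $ j $ i = - P $ i $ j"
  shows "\<exists>R\<in>SO. mat_exp (cmat_scale (\<i> * of_real s) P) = complexify R"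
proof -
  define e where "e s = cmat_scale (exp (\<i> * of_real s)) (half_proj P) + cmat_scale (exp (- (\<i> * of_real s))) (half_proj (- P))"
    for s :: real
  define R where "R s = (\<chi> i j. Re (e s $ i $ j))" for s
  have cnj_P: "cnj (P $ i $ j) = - P $ i $ j" for i j
    using arg_cong[OF herm, of "\<lambda>A. A $ j $ i"] anti[of j i] by simp
  have cnj_half: "cnj (half_proj P $ i $ j) = half_proj (- P) $ i $ j"
    "cnj (half_proj (- P) $ i $ j) = half_proj P $ i $ j" for i j
    by (simp_all add: half_proj_def mat_nth cnj_P)
  have "cnj (e s $ i $ j) = e s $ i $ j" for s i j
    by (simp add: e_def cnj_half exp_cnj add.commute)
  then have e: "complexify (R s) = e s" for s
    by (simp add: vec_eq_iff R_def) (metis Reals_cnj_iff of_real_Re)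
  have e_add: "e s ** e s' = e (s + s')" for s s'
    by (simp add: e_def matrix_add_ldistrib matrix_add_rdistrib cmat_scale_mult_left cmat_scale_mult_right
        half_proj_mult[OF P] algebra_simps flip: exp_add)
  have e_0: "e 0 = mat 1" by (simp add: e_def half_proj_add)
  have e_transpose: "transpose (e s) = e (- s)" for s
  proof -
    have "half_proj P $ j $ i = half_proj (- P) $ i $ j" for i j
      using anti[of j i] by (simp add: half_proj_def mat_nth)
    moreover from this have "half_proj (- P) $ j $ i = half_proj P $ i $ j" for i j by simp
    ultimately show ?thesis
      by (simp add: e_def vec_eq_iff transpose_def add.commute)
  qed
  have R_add: "R s ** R s' = R (s + s')" for s s'
    using e_add by (simp flip: complexify_inject add: complexify_mult e)
  have "transpose (R s) ** R s = mat 1" for s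
    by (simp flip: complexify_inject add: complexify_mult complexify_transpose e e_transpose e_add e_0)
  then have orth: "orthogonal_matrix (R s)" for s
    by (simp add: orthogonal_matrix)
  \<comment> \<open>The determinant is a square of \<open>1\<close> or \<open>- 1\<close>, since
    \<open>R s\<close> is the square of \<open>R (s / 2)\<close>.\<close>
  have "det (R s) = det (R (s / 2)) * det (R (s / 2))"
    by (simp flip: det_mul add: R_add)
  moreover have "det (R (s / 2)) = 1 \<or> det (R (s / 2)) = - 1"
    by (rule det_orthogonal_matrix[OF orth])
  ultimately have "R s \<in> SO" using orth by (auto simp: SO_def)
  moreover have "mat_exp (cmat_scale (\<i> * of_real s) P) = complexify (R s)"
    by (simp add: e mat_exp_involution[OF P] e_def)
  ultimately show ?thesis by blast
qed

section \<open>Distance between the frame average and the Haar average\<close>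

text \<open>Passes from the quadratic form to the norm without diagonalising \<open>f\<close>;
  positivity supplies the lower bound that the form estimate \<open>le\<close> lacks.\<close>

lemma psd_norm_bound:
  fixes f :: "'a::real_inner \<Rightarrow> 'a"
  assumes lin: "linear f" and sym: "\<And>x y. inner (f x) y = inner x (f y)"
    and sub: "subspace S" and inv: "\<And>x. x \<in> S \<Longrightarrow> f x \<in> S"
    and psd: "\<And>x. x \<in> S \<Longrightarrow> 0 \<le> inner x (f x)"
    and le: "\<And>x. x \<in> S \<Longrightarrow> inner x (f x) \<le> b * (norm x)\<^sup>2"
    and b: "b > 0" and x: "x \<in> S"
  shows "norm (f x) \<le> b * norm x"
proof -
  define y where "y = f x"
  have y: "y \<in> S" unfolding y_def using inv x by blast
  \<comment> \<open>Adding these two inequalities proves \<open>b (b f - f\<^sup>2) = (b - f) f (b - f) + f (b - f) f\<close> nonnegative.\<close>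
  have "0 \<le> inner (b *\<^sub>R x - y) (f (b *\<^sub>R x - y))"
    by (intro psd subspace_diff sub subspace_scale x y)
  moreover have "inner y (f y) \<le> b * (norm y)\<^sup>2" by (rule le[OF y])
  moreover have "inner x (f y) = inner y y" using sym[of x y] by (simp add: y_def)
  ultimately have "0 \<le> b * (b * inner x y - (norm y)\<^sup>2)"
    by (simp add: linear_diff[OF lin] linear_scale[OF lin] inner_diff_left inner_diff_right
        inner_commute[of y x] power2_norm_eq_inner flip: y_def)
  then have "(norm y)\<^sup>2 \<le> b * inner x y" using b by (simp add: zero_le_mult_iff)
  also have "\<dots> \<le> b * (b * (norm x)\<^sup>2)"
    using le[OF x] b by (simp add: y_def)
  finally have "(norm y)\<^sup>2 \<le> (b * norm x)\<^sup>2" by (simp add: power2_eq_square mult_ac)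
  then show ?thesis using b by (simp add: y_def power2_le_iff_abs_le)
qed

lemma weight_proj_uminus: "weight_proj (- P) K = weight_proj P (- K)"
  unfolding weight_proj_def by (intro arg_cong[where f = tensor_family]) auto

text \<open>Negating \<open>P\<close> complements the site sets, and complements of half-size sets
  have half size. Hence averaging over both signs is harmless.\<close>

lemma zero_proj_uminus: "zero_proj (- P) = (zero_proj P :: complex^('i::finite^'t::finite)^('i^'t))"
proof (cases "even CARD('t)")
  case True
  have "(\<Sum>K | card K = CARD('t) div 2. weight_proj P (- K)) =
      (\<Sum>K :: 't set | card K = CARD('t) div 2. weight_proj P K)"
    using True by (intro sum.reindex_bij_witness[of _ uminus uminus])
      (auto simp: Compl_eq_Diff_UNIV card_Diff_subset)
  then show ?thesis by (simp add: zero_proj_def level_proj_def weight_proj_uminus)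
qed (simp add: zero_proj_def)

lemma sum_op_zero_proj: "P ** P = mat 1 \<Longrightarrow> sum_op P ** zero_proj P = 0"
  by (auto simp: zero_proj_def sum_op_level_proj simp flip: of_nat_div)

lemma inner_zero_proj_nonneg:
  assumes "P ** P = mat 1" "mat_adj P = P"
  shows "0 \<le> inner v (zero_proj P *v v)"
  by (simp add: zero_proj_def level_proj_norm(1)[OF assms])

context antisymmetric_frame
begin

definition frame_mean :: "complex^('i^'t::finite)^('i^'t)" where
  "frame_mean = (1 / real (card Z)) *\<^sub>R (\<Sum>P\<in>Z. zero_proj P)"

text \<open>\<open>G\<close> is an orthogonal projection absorbed by \<open>A\<close> on both sides,
  so \<open>A - G\<close> acts as \<open>A\<close> on the kernel \<open>S\<close> of
  \<open>G\<close> and as zero on its complement.\<close>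

lemma norm_frame_mean_diff_haar:
  fixes v :: "complex^('i^'t::finite)" and \<mu> :: "(real^'i^'i) measure"
  assumes haar: "is_haar_SO \<mu>" and N: "CARD('i) \<ge> 3"
  defines "b \<equiv> 1 - 1 / (2 * real CARD('t)) * ((real CARD('i) - 2) / (real CARD('i) - 1))
      - 2 / (real CARD('i) * (real CARD('i) - 1))"
  shows "b > 0" and "norm ((frame_mean - haar_avg \<mu>) *v v) \<le> b * norm v"
proof -
  interpret haar_SO \<mu> by unfold_locales (rule haar)
  let ?N = "real CARD('i)" and ?t = "real CARD('t)"
  have N3: "?N \<ge> 3" using N by linarith
  \<comment> \<open>The two subtracted terms are at most 1/2 and 1/3.\<close>
  show b_pos: "b > 0"
  proof -
    have "1 / (2 * ?t) * ((?N - 2) / (?N - 1)) \<le> 1 / 2 * 1"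
      using N3 by (intro mult_mono) (auto simp: field_simps)
    moreover have "6 \<le> ?N * (?N - 1)"
      using mult_mono[of 3 ?N 2 "?N - 1"] N3 by simp
    then have "2 / (?N * (?N - 1)) \<le> 2 / 6"
      by (intro divide_left_mono) auto
    ultimately show ?thesis unfolding b_def by linarith
  qed
  define n where "n = real (card Z)"
  have n: "n = ?N * (?N - 1)" by (simp add: n_def card_frame)
  then have n_pos: "n > 0" using N3 by simp
  define A where "A = (frame_mean :: complex^('i^'t)^('i^'t))"
  define G where "G = (haar_avg \<mu> :: complex^('i^'t)^('i^'t))"
  define C where "C = (casimir :: complex^('i^'t)^('i^'t))"
  have A_eq: "A = cmat_scale (1 / of_real n) (\<Sum>P\<in>Z. zero_proj P)"
    by (simp add: A_def frame_mean_def n_def flip: cmat_scale_of_real)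
  have A_v: "A *v x = (1 / n) *\<^sub>R (\<Sum>P\<in>Z. zero_proj P *v x)" for x
    by (simp add: A_eq cmat_scale_vector matrix_vector_mult_sum_left scaleR_eq_vector_smult)
  have adj_A: "mat_adj A = A"
  proof -
    have "mat_adj (\<Sum>P\<in>Z. zero_proj P) = (\<Sum>P\<in>Z. zero_proj P :: complex^('i^'t)^('i^'t))"
      by (simp add: mat_adj_sum mat_adj_zero_proj hermitian)
    then show ?thesis by (simp add: A_eq vec_eq_iff)
  qed
  have adj_G: "mat_adj G = G" unfolding G_def by (rule mat_adj_haar_avg)
  have adj_C: "mat_adj C = C" unfolding C_def by (rule mat_adj_casimir)
  have PG: "zero_proj P ** G = G" if P: "P \<in> Z" for P
  proof (rule zero_proj_invariant[OF involution[OF P]])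
    fix \<theta> :: real
    obtain R where "R \<in> SO" "mat_exp (cmat_scale (\<i> * of_real (\<theta> / 2)) P) = complexify R"
      using mat_exp_antisymmetric_SO[OF involution[OF P] hermitian[OF P] antisymmetric[OF P]] by blast
    then show "tensor_pow (mat_exp (cmat_scale (\<i> * of_real (\<theta> / 2)) P)) ** G = G"
      by (simp only: G_def haar_avg_left_invariant)
  qed
  have "(\<Sum>P\<in>Z. zero_proj P) ** G = (\<Sum>P\<in>Z. G)"
    unfolding matrix_mult_sum_left by (intro sum.cong refl PG)
  also have "\<dots> = cmat_scale (of_real n) G"
    unfolding vec_eq_iff sum_component by (simp add: n_def)
  finally have AG: "A ** G = G"
    using n_pos by (simp add: A_eq cmat_scale_mult_left)
  have GA: "G ** A = G" using arg_cong[OF AG, of mat_adj] by (simp add: mat_adj_mult adj_A adj_G)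
  have GG: "G ** G = G"
  proof -
    \<comment> \<open>Each \<open>G *v x\<close> is invariant under rotations, hence fixed by
      \<open>G\<close>.\<close>
    have "G *v (G *v x) = G *v x" for x
      unfolding G_def
      by (rule haar_avg_fixes_invariant) (simp add: matrix_vector_mul_assoc haar_avg_left_invariant)
    then show ?thesis by (simp add: matrix_eq matrix_vector_mul_assoc)
  qed
  have "C ** G = 0"
  proof -
    have "sum_op P ** G = 0" if "P \<in> Z" for P
      by (subst PG[OF that, symmetric])
        (simp add: matrix_mul_assoc sum_op_zero_proj[OF involution[OF that]])
    then show ?thesis
      by (simp add: C_def casimir_def matrix_mult_sum_left flip: matrix_mul_assoc)
  qed
  then have "mat_adj (C ** G) = 0" by (simp add: vec_eq_iff)
  then have GC: "G ** C = 0" by (simp add: mat_adj_mult adj_C adj_G)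
  have AC: "A ** C = C ** A"
  proof -
    have "C ** zero_proj P = zero_proj P ** C" if "P \<in> Z" for P
      by (simp add: zero_proj_def C_def commute_level_proj[OF involution[OF that] casimir_commute[OF that, symmetric]])
    then show ?thesis
      by (simp add: A_eq cmat_scale_mult_left cmat_scale_mult_right matrix_mult_sum_left matrix_mult_sum_right)
  qed
  define S where "S = {x. G *v x = 0}"
  have sub_S: "subspace S"
    by (auto simp: S_def subspace_def matrix_vector_right_distrib complex_matrix_vector_scaleR)
  have inv_S: "A *v x \<in> S" if "x \<in> S" for x
    using that by (simp add: S_def matrix_vector_mul_assoc GA)
  have lin: "linear ((*v) M)" for M :: "complex^('i^'t)^('i^'t)"
    by (rule matrix_vector_mul_linear)
  have bound: "inner x (A *v x) \<le> b * (norm x)\<^sup>2" if x: "x \<in> S" for x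
  proof (cases "x = 0")
    case False
    \<comment> \<open>Since \<open>a\<close> bounds the form on all of \<open>S\<close>, any one
      vector of its eigenspace \<open>E\<close> suffices to estimate it; \<open>C\<close> preserves
      \<open>E\<close>, so a common eigenvector of \<open>A\<close> and \<open>C\<close> can be
      chosen.\<close>
    obtain v0 a where v0: "v0 \<in> S" "v0 \<noteq> 0" "A *v v0 = a *\<^sub>R v0"
      and max: "\<And>w. w \<in> S \<Longrightarrow> inner w (A *v w) \<le> a * (norm w)\<^sup>2"
      using selfadjoint_max_eigenvector[OF lin sub_S inv_S inner_hermitian[OF adj_A] x False] by blast
    define E where "E = {w \<in> S. A *v w = a *\<^sub>R w}"
    have sub_E: "subspace E"
      using sub_S by (auto simp: E_def subspace_def matrix_vector_right_distrib
          complex_matrix_vector_scaleR scaleR_add_right)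
    have inv_E: "C *v w \<in> E" if "w \<in> E" for w
      using that commuting_eigenspace[OF AC[symmetric], of w a]
      by (auto simp: E_def S_def matrix_vector_mul_assoc GC)
    have "v0 \<in> E" using v0 by (simp add: E_def)
    obtain w c where w: "w \<in> E" "w \<noteq> 0" "C *v w = c *\<^sub>R w"
      using selfadjoint_max_eigenvector[OF lin sub_E inv_E inner_hermitian[OF adj_C] \<open>v0 \<in> E\<close> v0(2)] by blast
    \<comment> \<open>A vector killed by the whole frame would be fixed by \<open>G\<close>, but
      \<open>w\<close> is a nonzero vector of its kernel.\<close>
    have moved: "\<exists>P\<in>Z. sum_op P *v w \<noteq> 0"
    proof (rule ccontr)
      assume "\<not> ?thesis"
      then have "G *v w = w"
        unfolding G_def by (intro haar_avg_fixes_invariant SO_invariant) auto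
      then show False using w by (simp add: E_def S_def)
    qed
    have "(2 + ?N * (?N - 2) / (2 * ?t)) * (norm w)\<^sup>2 \<le> (\<Sum>P\<in>Z. (norm w)\<^sup>2 - inner w (zero_proj P *v w))"
      using N by (intro zero_proj_gap[OF w(2) w(3)[unfolded C_def] moved]) simp
    also have "\<dots> = n * (norm w)\<^sup>2 - n * inner w (A *v w)"
      using n_pos by (simp add: sum_subtractf A_v inner_sum_right) (simp add: n_def)
    also have "\<dots> = n * (1 - a) * (norm w)\<^sup>2"
      using w(1) by (simp add: E_def power2_norm_eq_inner algebra_simps)
    finally have "2 + ?N * (?N - 2) / (2 * ?t) \<le> n * (1 - a)"
      using w(2) by simp
    then have "(2 + ?N * (?N - 2) / (2 * ?t)) / n \<le> 1 - a"
      using n_pos by (simp add: field_simps)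
    moreover have "(2 + ?N * (?N - 2) / (2 * ?t)) / n = 1 - b"
    proof -
      have "?N * (?N - 2) / (2 * ?t) / (?N * (?N - 1)) = 1 / (2 * ?t) * ((?N - 2) / (?N - 1))"
        using N3 by (simp add: field_simps)
      then show ?thesis by (simp add: n b_def add_divide_distrib)
    qed
    ultimately have "a \<le> b" by simp
    then have "a * (norm x)\<^sup>2 \<le> b * (norm x)\<^sup>2" by (rule mult_right_mono) simp
    then show ?thesis using max[OF x] by linarith
  qed simp
  have psd: "0 \<le> inner x (A *v x)" for x
    using n_pos by (simp add: A_v inner_sum_right)
      (intro divide_nonneg_pos sum_nonneg inner_zero_proj_nonneg involution hermitian)
  define v' where "v' = v - G *v v"
  have v': "v' \<in> S" by (simp add: S_def v'_def matrix_vector_mult_diff_distrib matrix_vector_mul_assoc GG)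
  have "inner (G *v v) v' = 0"
    using v' inner_hermitian[OF adj_G, of v v'] by (simp add: S_def)
  then have "(norm v)\<^sup>2 = (norm (G *v v))\<^sup>2 + (norm v')\<^sup>2"
    using norm_add_Pythagorean[of "G *v v" v'] by (simp add: orthogonal_def v'_def)
  then have "(norm v')\<^sup>2 \<le> (norm v)\<^sup>2" by simp
  then have norm_le: "norm v' \<le> norm v" by simp
  have "(A - G) *v v = A *v v'"
    by (simp add: v'_def matrix_vector_mult_diff_distrib matrix_vector_mult_diff_rdistrib
        matrix_vector_mul_assoc AG)
  then have "norm ((A - G) *v v) \<le> b * norm v'"
    using psd_norm_bound[OF lin inner_hermitian[OF adj_A] sub_S inv_S psd bound b_pos v'] by simp
  also have "\<dots> \<le> b * norm v" using norm_le b_pos by simp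
  finally show "norm ((frame_mean - haar_avg \<mu>) *v v) \<le> b * norm v" by (simp add: A_def G_def)
qed

end

section \<open>Pauli strings with an odd number of factors Y\<close>

lemma UNIV_pauli_letter: "UNIV = {PI, PX, PY, PZ}"
  using pauli_letter.exhaust by blast

lemma finite_pauli_letter [simp]: "finite (UNIV :: pauli_letter set)"
  by (simp add: UNIV_pauli_letter)

lemma sum_pauli_letter: "(\<Sum>a\<in>UNIV. f a) = f PI + f PX + f PY + (f PZ :: complex)"
  by (simp add: UNIV_pauli_letter add.assoc)

lemma prod_sum_fun:
  fixes f :: "'q::finite \<Rightarrow> 'b \<Rightarrow> 'a::comm_ring_1"
  assumes "finite (UNIV :: 'b set)"
  shows "(\<Prod>q\<in>UNIV. \<Sum>b\<in>UNIV. f q b) = (\<Sum>g\<in>UNIV. \<Prod>q\<in>UNIV. f q (g q))"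
  using assms by (subst prod_sum_PiE) auto

lemma finite_pauli_strings [simp]: "finite (UNIV :: ('q::finite \<Rightarrow> pauli_letter) set)"
  using finite_PiE[of "UNIV :: 'q set" "\<lambda>_. UNIV :: pauli_letter set"] by simp

lemma prod_delta_fun:
  "(\<Prod>q\<in>UNIV. if f q = g q then c else 0) = (if f = g then c ^ CARD('q) else (0 :: complex))"
  for f g :: "'q::finite \<Rightarrow> 'b"
proof (cases "f = g")
  case False
  then obtain q where "f q \<noteq> g q" by auto
  then show ?thesis using False by (auto intro!: prod_zero)
qed simp

text \<open>The sign acquired under transposition: \<open>PY\<close> is the only antisymmetric
  letter.\<close>

definition letter_sign :: "pauli_letter \<Rightarrow> complex" where
  "letter_sign a = (if a = PY then - 1 else 1)"

definition string_sign :: "('q::finite \<Rightarrow> pauli_letter) \<Rightarrow> complex" where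
  "string_sign a = (\<Prod>q\<in>UNIV. letter_sign (a q))"

lemma string_sign_eq: "string_sign a = (- 1) ^ card {q. a q = PY}"
  by (simp add: string_sign_def letter_sign_def prod.If_cases)

lemma pauli_nth: "pauli a $ x $ y = (\<Prod>q\<in>UNIV. pauli1 (a q) (x q) (y q))"
  by (simp add: pauli_def)

lemma pauli1_transpose: "pauli1 a c b = letter_sign a * pauli1 a b c"
  by (cases a; cases b; cases c) (simp_all add: letter_sign_def)

lemma pauli1_cnj: "cnj (pauli1 a c b) = pauli1 a b c"
  by (cases a; cases b; cases c) simp_all

lemma pauli1_completeness:
  "(\<Sum>a\<in>UNIV. pauli1 a b c * pauli1 a d e) = (if (b, c) = (e, d) then 2 else 0)"
  "(\<Sum>a\<in>UNIV. letter_sign a * (pauli1 a b c * pauli1 a d e)) = (if (b, c) = (d, e) then 2 else 0)"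
  by (cases b; cases c; cases d; cases e; simp add: sum_pauli_letter letter_sign_def)+

lemma pauli_transpose: "pauli a $ y $ x = string_sign a * pauli a $ x $ y"
  unfolding pauli_nth string_sign_def prod.distrib[symmetric]
  by (intro prod.cong refl pauli1_transpose)

lemma mat_adj_pauli: "mat_adj (pauli a) = pauli a"
  by (simp add: vec_eq_iff pauli_nth pauli1_cnj)

text \<open>\<open>(1 - string_sign a) / 2\<close> is the indicator of an odd number of
  \<open>PY\<close>. The unsigned and the signed sum over all strings both factor over the qubits,
  each giving one of the two deltas.\<close>

lemma pauli_completeness:
  fixes x y z w :: "'q::finite \<Rightarrow> bool"
  shows "(\<Sum>a | odd (card {q. a q = PY}). pauli a $ x $ y * pauli a $ z $ w) =
    2 ^ CARD('q) / 2 * ((if x = w \<and> y = z then 1 else 0) - (if x = z \<and> y = w then 1 else 0))"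
proof -
  have sign: "(1 - string_sign a) / 2 = (if odd (card {q. a q = PY}) then 1 else 0)"
    for a :: "'q \<Rightarrow> pauli_letter"
    by (simp add: string_sign_eq)
  have 1: "(\<Sum>a\<in>UNIV. pauli a $ x $ y * pauli a $ z $ w) = (if x = w \<and> y = z then 2 ^ CARD('q) else 0)"
  proof -
    have "(\<Sum>a\<in>UNIV. pauli a $ x $ y * pauli a $ z $ w) =
        (\<Prod>q\<in>UNIV. \<Sum>a\<in>UNIV. pauli1 a (x q) (y q) * pauli1 a (z q) (w q))"
      by (simp add: pauli_nth prod_sum_fun flip: prod.distrib)
    also have "\<dots> = (if (\<lambda>q. (x q, y q)) = (\<lambda>q. (w q, z q)) then 2 ^ CARD('q) else 0)"
      unfolding pauli1_completeness(1) by (rule prod_delta_fun)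
    finally show ?thesis by (simp add: fun_eq_iff)
  qed
  have 2: "(\<Sum>a\<in>UNIV. string_sign a * (pauli a $ x $ y * pauli a $ z $ w)) = (if x = z \<and> y = w then 2 ^ CARD('q) else 0)"
  proof -
    have "(\<Sum>a\<in>UNIV. string_sign a * (pauli a $ x $ y * pauli a $ z $ w)) =
        (\<Prod>q\<in>UNIV. \<Sum>a\<in>UNIV. letter_sign a * (pauli1 a (x q) (y q) * pauli1 a (z q) (w q)))"
      by (simp add: pauli_nth prod_sum_fun string_sign_def flip: prod.distrib)
    also have "\<dots> = (if (\<lambda>q. (x q, y q)) = (\<lambda>q. (z q, w q)) then 2 ^ CARD('q) else 0)"
      unfolding pauli1_completeness(2) by (rule prod_delta_fun)
    finally show ?thesis by (simp add: fun_eq_iff)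
  qed
  have "(\<Sum>a | odd (card {q. a q = PY}). pauli a $ x $ y * pauli a $ z $ w) =
      (\<Sum>a\<in>UNIV. (1 - string_sign a) / 2 * (pauli a $ x $ y * pauli a $ z $ w))"
    unfolding sign by (simp add: sum.If_cases if_distrib[where f = "\<lambda>u. u * _"] cong: if_cong)
  also have "\<dots> = ((\<Sum>a\<in>UNIV. pauli a $ x $ y * pauli a $ z $ w) -
      (\<Sum>a\<in>UNIV. string_sign a * (pauli a $ x $ y * pauli a $ z $ w))) / 2"
    by (simp add: sum_subtractf algebra_simps flip: sum_divide_distrib)
  also have "\<dots> = 2 ^ CARD('q) / 2 * ((if x = w \<and> y = z then 1 else 0) - (if x = z \<and> y = w then 1 else 0))"
  proof -
    have "((if A then c else 0) - (if B then c else 0)) / 2 = c / 2 * ((if A then 1 else 0) - (if B then 1 else 0))"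
      for A B and c :: complex by simp
    then show ?thesis unfolding 1 2 .
  qed
  finally show ?thesis .
qed

section \<open>Products and traces of Pauli strings\<close>

lemma pauli_mult_nth:
  "(pauli a ** pauli b) $ x $ y = (\<Prod>q\<in>UNIV. \<Sum>c\<in>UNIV. pauli1 (a q) (x q) c * pauli1 (b q) c (y q))"
  by (simp add: matrix_mult_nth pauli_nth prod_sum_fun flip: prod.distrib)

lemma pauli_square: "pauli a ** pauli a = mat 1"
proof -
  have "(\<Sum>c\<in>UNIV. pauli1 l b c * pauli1 l c d) = (if b = d then 1 else 0)" for l b d
    by (cases l; cases b; cases d) (simp_all add: UNIV_bool)
  then have "(pauli a ** pauli a) $ x $ y = mat 1 $ x $ y" for x y
    using prod_delta_fun[of x y 1] by (simp add: pauli_mult_nth mat_nth)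
  then show ?thesis by (simp add: vec_eq_iff)
qed

lemma pauli_commute_or_anticommute:
  "pauli a ** pauli b = pauli b ** pauli a \<or> pauli a ** pauli b = - (pauli b ** pauli a)"
proof -
  define s where "s l m = (if l = PI \<or> m = PI \<or> l = m then 1 else - 1 :: complex)" for l m
  have 1: "(\<Sum>c\<in>UNIV. pauli1 l b c * pauli1 m c d) = s l m * (\<Sum>c\<in>UNIV. pauli1 m b c * pauli1 l c d)" for l m b d
    by (cases l; cases m; cases b; cases d) (simp_all add: UNIV_bool s_def)
  define S where "S = (\<Prod>q\<in>UNIV. s (a q) (b q))"
  have eq: "(pauli a ** pauli b) $ x $ y = S * (pauli b ** pauli a) $ x $ y" for x y
    unfolding pauli_mult_nth S_def prod.distrib[symmetric] by (intro prod.cong refl 1)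
  have "(s l m)\<^sup>2 = 1" for l m by (simp add: s_def)
  then have "S\<^sup>2 = 1" by (simp add: S_def prod_power_distrib)
  then have "S = 1 \<or> S = - 1" by (simp add: power2_eq_1_iff)
  then show ?thesis using eq by (auto simp: vec_eq_iff)
qed

text \<open>Recording that the phase is a fourth root of unity lets Hermiticity later reduce it to a
  sign.\<close>

lemma pauli1_mult:
  "\<exists>r \<phi>. \<phi> ^ 4 = 1 \<and> (\<forall>b d. (\<Sum>c\<in>UNIV. pauli1 l b c * pauli1 m c d) = \<phi> * pauli1 r b d)"
proof -
  have i4: "\<i> ^ 4 = 1" "(- \<i>) ^ 4 = 1"
    by (simp_all add: power4_eq_xxxx)
  have w: "\<phi> ^ 4 = 1 \<Longrightarrow> (\<And>b d. (\<Sum>c\<in>UNIV. pauli1 l b c * pauli1 m c d) = \<phi> * pauli1 r b d) \<Longrightarrow> ?thesis" for \<phi> r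
    by blast
  show ?thesis
    apply (cases l; cases m)
                   apply (rule w[of 1 PI]; simp add: UNIV_bool)
                  apply (rule w[of 1 PX]; simp add: UNIV_bool)
                 apply (rule w[of 1 PY]; simp add: UNIV_bool)
                apply (rule w[of 1 PZ]; simp add: UNIV_bool)
               apply (rule w[of 1 PX]; simp add: UNIV_bool)
              apply (rule w[of 1 PI]; simp add: UNIV_bool)
             apply (rule w[of "\<i>" PZ]; simp add: UNIV_bool i4)
            apply (rule w[of "- \<i>" PY]; simp add: UNIV_bool i4)
           apply (rule w[of 1 PY]; simp add: UNIV_bool)
          apply (rule w[of "- \<i>" PZ]; simp add: UNIV_bool i4)
         apply (rule w[of 1 PI]; simp add: UNIV_bool)
        apply (rule w[of "\<i>" PX]; simp add: UNIV_bool i4)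
       apply (rule w[of 1 PZ]; simp add: UNIV_bool)
      apply (rule w[of "\<i>" PY]; simp add: UNIV_bool i4)
     apply (rule w[of "- \<i>" PX]; simp add: UNIV_bool i4)
    apply (rule w[of 1 PI]; simp add: UNIV_bool)
    done
qed

lemma pauli_mult: "\<exists>c \<phi>. \<phi> ^ 4 = 1 \<and> pauli a ** pauli b = cmat_scale \<phi> (pauli c)"
proof -
  obtain r f where rf: "\<And>l m. f l m ^ 4 = 1"
    "\<And>l m b d. (\<Sum>c\<in>UNIV. pauli1 l b c * pauli1 m c d) = f l m * pauli1 (r l m) b d"
    using pauli1_mult by metis
  show ?thesis
  proof (intro exI conjI)
    show "(\<Prod>q\<in>UNIV. f (a q) (b q)) ^ 4 = 1"
      by (simp add: rf prod_power_distrib)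
    show "pauli a ** pauli b = cmat_scale (\<Prod>q\<in>UNIV. f (a q) (b q)) (pauli (\<lambda>q. r (a q) (b q)))"
      by (simp add: vec_eq_iff pauli_mult_nth rf prod.distrib pauli_nth)
  qed
qed

lemma pauli_nonzero: "pauli (a :: 'q::finite \<Rightarrow> pauli_letter) \<noteq> 0"
proof
  assume "pauli a = 0"
  then have "(mat 1 :: complex^('q \<Rightarrow> bool)^('q \<Rightarrow> bool)) = 0"
    using pauli_square[of a] by simp
  then have "(mat 1 :: complex^('q \<Rightarrow> bool)^('q \<Rightarrow> bool)) $ x $ x = 0" for x by simp
  then show False by (simp add: mat_nth)
qed

lemma pauli_trace:
  fixes a b :: "'q::finite \<Rightarrow> pauli_letter"
  shows "(\<Sum>x\<in>UNIV. (pauli a ** pauli b) $ x $ x) = (if a = b then 2 ^ CARD('q) else 0)"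
proof -
  have "(\<Sum>d\<in>UNIV. \<Sum>c\<in>UNIV. pauli1 l d c * pauli1 m c d) = (if l = m then 2 else 0)" for l m
    by (cases l; cases m) (simp_all add: UNIV_bool)
  moreover have "(\<Sum>x\<in>UNIV. (pauli a ** pauli b) $ x $ x) =
      (\<Prod>q\<in>UNIV. \<Sum>d\<in>UNIV. \<Sum>c\<in>UNIV. pauli1 (a q) d c * pauli1 (b q) c d)"
    unfolding pauli_mult_nth by (rule prod_sum_fun[symmetric]) simp
  ultimately show ?thesis by (simp only: prod_delta_fun)
qed

lemma trace_pauli_square: "(\<Sum>x\<in>UNIV. (pauli a ** pauli a) $ x $ x) \<noteq> 0"
  by (simp add: pauli_trace)

lemma inj_pauli: "inj pauli"
proof (rule injI)
  fix a b :: "'q::finite \<Rightarrow> pauli_letter"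
  assume "pauli a = pauli b"
  then have "(\<Sum>x\<in>UNIV. (pauli a ** pauli b) $ x $ x) \<noteq> 0"
    using trace_pauli_square[of a] by simp
  then show "a = b" by (simp add: pauli_trace split: if_splits)
qed

text \<open>The trace of a product of two strings is 0 or N, never - N. This keeps
  \<open>Ypaulis\<close> and its negatives disjoint.\<close>

lemma pauli_neq_uminus: "pauli a \<noteq> - pauli b"
proof
  assume eq: "pauli a = - pauli b"
  define T where "T = (\<Sum>x\<in>UNIV. (pauli a ** pauli a) $ x $ x)"
  have "(\<Sum>x\<in>UNIV. (pauli b ** pauli a) $ x $ x) = - T"
    by (simp add: T_def eq matrix_mult_uminus_left matrix_mult_uminus_right sum_negf)
  then show False
    by (auto simp: T_def pauli_trace split: if_splits)
qed

lemma of_real_root_of_unity_4: "\<phi> ^ 4 = 1 \<Longrightarrow> cnj \<phi> = \<phi> \<Longrightarrow> \<phi> = 1 \<or> \<phi> = - 1" for \<phi> :: complex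
proof -
  assume 4: "\<phi> ^ 4 = 1" and r: "cnj \<phi> = \<phi>"
  then obtain u :: real where u: "\<phi> = of_real u" by (metis Reals_cases Reals_cnj_iff)
  then have "u ^ 4 = 1" using 4 by (metis of_real_eq_1_iff of_real_power)
  then have "\<bar>u\<bar> = 1" by (metis power_eq_1_iff zero_neq_numeral real_norm_def)
  then show ?thesis using u by (auto simp: abs_if split: if_splits)
qed

text \<open>For anticommuting \<open>P\<close>, \<open>Q\<close> in \<open>Ypaulis\<close> the product \<open>i P Q\<close> lies in \<open>Ypaulis\<close> only up to sign.\<close>

definition signed_Ypaulis :: "(complex^('q::finite \<Rightarrow> bool)^('q \<Rightarrow> bool)) set" where
  "signed_Ypaulis = Ypaulis \<union> uminus ` Ypaulis"

lemma Ypaulis_image: "Ypaulis = pauli ` {a. odd (card {q. a q = PY})}"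
  by (auto simp: Ypaulis_def)

lemma finite_Ypaulis [simp]: "finite Ypaulis"
  by (simp add: Ypaulis_image finite_subset[OF subset_UNIV])

lemma Ypaulis_antisymmetric: "P \<in> Ypaulis \<Longrightarrow> P $ j $ i = - P $ i $ j"
  using pauli_transpose[of _ j i] by (auto simp: Ypaulis_def string_sign_eq)

lemma sum_signed_Ypaulis:
  fixes f :: "complex^('q::finite \<Rightarrow> bool)^('q \<Rightarrow> bool) \<Rightarrow> 'a::real_vector"
  assumes "\<And>P. f (- P) = f P"
  shows "(\<Sum>P\<in>signed_Ypaulis. f P) = 2 *\<^sub>R (\<Sum>P\<in>Ypaulis. f P)"
proof -
  have "Ypaulis \<inter> uminus ` Ypaulis = ({} :: (complex^('q \<Rightarrow> bool)^('q \<Rightarrow> bool)) set)"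
    by (auto simp: Ypaulis_def pauli_neq_uminus[symmetric])
  then have "(\<Sum>P\<in>signed_Ypaulis. f P) = (\<Sum>P\<in>Ypaulis. f P) + (\<Sum>P\<in>uminus ` Ypaulis. f P)"
    unfolding signed_Ypaulis_def by (intro sum.union_disjoint) simp_all
  also have "(\<Sum>P\<in>uminus ` Ypaulis. f P) = (\<Sum>P\<in>Ypaulis. f P)"
    by (subst sum.reindex) (simp_all add: assms inj_on_def)
  finally show ?thesis by (simp add: scaleR_2)
qed

text \<open>The product is a phase times a string \<open>c\<close>. Hermiticity of
  \<open>\<i>\<close> times the product leaves only a sign, and transposing the product shows that
  \<open>c\<close> is antisymmetric, so it has an odd number of \<open>PY\<close>.\<close>

lemma Ypaulis_mult_closed:
  assumes P: "P \<in> Ypaulis" and Q: "Q \<in> Ypaulis" and anti: "P ** Q = - (Q ** P)"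
  shows "cmat_scale \<i> (P ** Q) \<in> signed_Ypaulis"
proof -
  obtain a b where ab: "P = pauli a" "Q = pauli b"
    using P Q by (auto simp: Ypaulis_def)
  obtain c \<phi> where c: "\<phi> ^ 4 = 1" "P ** Q = cmat_scale \<phi> (pauli c)"
    using pauli_mult[of a b] ab by auto
  define R where "R = cmat_scale \<i> (P ** Q)"
  define \<psi> where "\<psi> = \<i> * \<phi>"
  have R: "R = cmat_scale \<psi> (pauli c)" by (simp add: R_def c \<psi>_def)
  have \<psi>4: "\<psi> ^ 4 = 1" using c by (simp add: \<psi>_def power_mult_distrib)
  obtain x y where xy: "pauli c $ x $ y \<noteq> 0"
    using pauli_nonzero[of c] by (auto simp: vec_eq_iff)
  have "mat_adj (P ** Q) = - (P ** Q)"
    unfolding mat_adj_mult using anti by (simp add: ab mat_adj_pauli)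
  then have "mat_adj R = R" by (simp add: R_def vec_eq_iff)
  then have "cnj (R $ y $ x) = R $ x $ y" by (metis mat_adj_nth)
  moreover have "cnj (pauli c $ y $ x) = pauli c $ x $ y" by (metis mat_adj_nth mat_adj_pauli)
  ultimately have "cnj \<psi> * pauli c $ x $ y = \<psi> * pauli c $ x $ y" by (simp add: R)
  then have \<psi>: "\<psi> = 1 \<or> \<psi> = - 1"
    using xy \<psi>4 by (intro of_real_root_of_unity_4) simp_all
  have "(P ** Q) $ y $ x = (Q ** P) $ x $ y"
    unfolding matrix_mult_nth
    by (intro sum.cong refl) (simp add: Ypaulis_antisymmetric[OF P, of y] Ypaulis_antisymmetric[OF Q, of _ x])
  also have "\<dots> = - (P ** Q) $ x $ y" by (simp add: anti)
  finally have "\<phi> * ((string_sign c + 1) * pauli c $ x $ y) = 0"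
    using c(2) by (simp add: pauli_transpose[of c y x] algebra_simps)
  moreover have "\<phi> \<noteq> 0" using c(1) by auto
  ultimately have "string_sign c = - 1" using xy by (simp add: eq_neg_iff_add_eq_0)
  then have "odd (card {q. c q = PY})" by (auto simp: string_sign_eq)
  then have "pauli c \<in> Ypaulis" by (auto simp: Ypaulis_def)
  then show ?thesis using \<psi> R by (auto simp: signed_Ypaulis_def R_def)
qed

lemma card_bit_strings: "CARD('q::finite \<Rightarrow> bool) = 2 ^ CARD('q)"
  by (simp add: card_fun)

lemma antisymmetric_frame_signed_Ypaulis:
  "antisymmetric_frame (signed_Ypaulis :: (complex^('q::finite \<Rightarrow> bool)^('q \<Rightarrow> bool)) set)"
proof
  let ?Z = "signed_Ypaulis :: (complex^('q \<Rightarrow> bool)^('q \<Rightarrow> bool)) set"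
  have cases: "(\<exists>a. odd (card {q. a q = PY}) \<and> (P = pauli a \<or> P = - pauli a))" if "P \<in> ?Z" for P
    using that by (auto simp: signed_Ypaulis_def Ypaulis_def)
  show "finite ?Z" by (simp add: signed_Ypaulis_def)
  show "P ** P = mat 1" if "P \<in> ?Z" for P
    using cases[OF that] by (auto simp: pauli_square matrix_mult_uminus_left matrix_mult_uminus_right)
  show "mat_adj P = P" if "P \<in> ?Z" for P
    using cases[OF that] by (auto simp: mat_adj_pauli mat_adj_uminus)
  show "P $ j $ i = - P $ i $ j" if "P \<in> ?Z" for P i j
    using that by (auto simp: signed_Ypaulis_def Ypaulis_antisymmetric[of _ j i])
  show uminus: "- P \<in> ?Z" if "P \<in> ?Z" for P
    using that by (auto simp: signed_Ypaulis_def)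
  show "P ** Q = Q ** P \<or> P ** Q = - (Q ** P)" if PQ: "P \<in> ?Z" "Q \<in> ?Z" for P Q
  proof -
    obtain a b where "P = pauli a \<or> P = - pauli a" "Q = pauli b \<or> Q = - pauli b"
      using PQ[THEN cases] by blast
    then show ?thesis using pauli_commute_or_anticommute[of a b]
      by (auto simp: matrix_mult_uminus_left matrix_mult_uminus_right)
  qed
  show "cmat_scale \<i> (P ** Q) \<in> ?Z" if PQ: "P \<in> ?Z" "Q \<in> ?Z" "P ** Q = - (Q ** P)" for P Q
  proof -
    obtain P' Q' where P': "P' \<in> Ypaulis" "P = P' \<or> P = - P'" and Q': "Q' \<in> Ypaulis" "Q = Q' \<or> Q = - Q'"
      using PQ(1,2) by (auto simp: signed_Ypaulis_def)
    have anti: "P' ** Q' = - (Q' ** P')"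
      using P'(2) Q'(2) PQ(3) by (auto simp: matrix_mult_uminus_left matrix_mult_uminus_right minus_equation_iff[of "P' ** Q'"])
    have "cmat_scale \<i> (- A) = - cmat_scale \<i> A" for A :: "complex^('q \<Rightarrow> bool)^('q \<Rightarrow> bool)"
      by (simp add: vec_eq_iff)
    then show ?thesis
      using Ypaulis_mult_closed[OF P'(1) Q'(1) anti] uminus P'(2) Q'(2)
      by (auto simp: matrix_mult_uminus_left matrix_mult_uminus_right)
  qed
  show "(\<Sum>P\<in>?Z. P $ i $ j * P $ k $ l) = of_nat CARD('q \<Rightarrow> bool) *
      ((if i = l \<and> j = k then 1 else 0) - (if i = k \<and> j = l then 1 else 0))" for i j k l
  proof -
    have "(\<Sum>P\<in>?Z. P $ i $ j * P $ k $ l) = 2 *\<^sub>R (\<Sum>P\<in>Ypaulis. P $ i $ j * P $ k $ l)"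
      by (rule sum_signed_Ypaulis) simp
    also have "(\<Sum>P\<in>Ypaulis. P $ i $ j * P $ k $ l) =
        (\<Sum>a | odd (card {q. a q = PY}). pauli a $ i $ j * pauli a $ k $ l)"
      unfolding Ypaulis_image by (subst sum.reindex) (auto intro: inj_on_subset[OF inj_pauli])
    finally show ?thesis
      unfolding pauli_completeness by (simp add: card_bit_strings scaleR_conv_of_real[where 'a=complex])
  qed
qed

interpretation signed_Ypaulis: antisymmetric_frame "signed_Ypaulis :: (complex^('q::finite \<Rightarrow> bool)^('q \<Rightarrow> bool)) set"
  by (rule antisymmetric_frame_signed_Ypaulis)

text \<open>Passing to both signs doubles the sum of projections and the normalising cardinality
  alike.\<close>

lemma pauli_avg_eq:
  "(pauli_avg :: complex^(('q::finite \<Rightarrow> bool)^'t::finite)^(('q \<Rightarrow> bool)^'t)) = signed_Ypaulis.frame_mean"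
proof -
  let ?Y = "Ypaulis :: (complex^('q \<Rightarrow> bool)^('q \<Rightarrow> bool)) set"
  let ?Z = "signed_Ypaulis :: (complex^('q \<Rightarrow> bool)^('q \<Rightarrow> bool)) set"
  have card: "real (card ?Z) = 2 * real (card ?Y)"
    using sum_signed_Ypaulis[of "\<lambda>_ :: complex^('q \<Rightarrow> bool)^('q \<Rightarrow> bool). 1 :: real"] by simp
  have "pauli_avg $ x $ y = signed_Ypaulis.frame_mean $ x $ y" for x y :: "('q \<Rightarrow> bool)^'t"
  proof -
    have int: "integral {- 2 * pi..2 * pi} (\<lambda>\<theta>. tensor_pow (mat_exp (cmat_scale (\<i> * of_real (\<theta> / 2)) P)) $ x $ y)
        = 4 * pi * zero_proj P $ x $ y" if "P \<in> ?Y" for P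
      using that pauli_square
      by (intro integral_unique has_integral_tensor_pow_mat_exp) (auto simp: Ypaulis_def)
    have "pauli_avg $ x $ y = 1 / of_nat (card ?Y) * (\<Sum>P\<in>?Y. zero_proj P $ x $ y)"
      unfolding pauli_avg_def by (simp add: int[simplified] cong: sum.cong)
    moreover have "(\<Sum>P\<in>?Z. zero_proj P $ x $ y) = 2 *\<^sub>R (\<Sum>P\<in>?Y. zero_proj P $ x $ y)"
      by (rule sum_signed_Ypaulis) (simp add: zero_proj_uminus)
    ultimately show ?thesis
      unfolding signed_Ypaulis.frame_mean_def card
      by (simp add: sum_component scaleR_conv_of_real[where 'a=complex])
  qed
  then show ?thesis by (simp add: vec_eq_iff)
qed

theorem theorem6p1:
  fixes \<mu> :: "(real^('q::finite \<Rightarrow> bool)^('q \<Rightarrow> bool)) measure"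
  assumes "(2::nat) ^ CARD('q) > 4"
    and "is_haar_SO \<mu>"
  shows "op_norm ((pauli_avg :: complex^(('q \<Rightarrow> bool)^'t::finite)^(('q \<Rightarrow> bool)^'t))
                   - haar_avg \<mu>)
         \<le> 1 - 1 / (2 * real CARD('t)) * ((2 ^ CARD('q) - 2) / (2 ^ CARD('q) - 1))
             - 2 / (2 ^ CARD('q) * (2 ^ CARD('q) - 1))"
proof -
  have N: "CARD('q \<Rightarrow> bool) \<ge> 3" using assms(1) by (simp add: card_bit_strings)
  note bound = signed_Ypaulis.norm_frame_mean_diff_haar[OF assms(2) N, where ?'t = 't]
  show ?thesis
    unfolding op_norm_def pauli_avg_eq
    by (rule onorm_bound) (use bound in \<open>simp_all add: card_bit_strings less_imp_le\<close>)
qed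

end
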